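(* Let $p:\mathbb C^n\to\mathbb R$ be a plurisubharmonic function such that (a) $p^*(w):=\sup\{\operatorname{Re}\langle z,w\rangle-p(z): z\in\mathbb C^n\}<\infty$ for every $w\in\mathbb C^n$, and (b) $\lim_{|z|\to\infty}\tilde p(z)/p(z)=1$, where $\tilde p(z)=\sup\{p(z+\zeta):|\zeta|\le1\}$. Then for each $\sigma>0$ there exists $\tau$ with $0<\tau<\sigma$ such that the canonical solution operator $$S_1:A^2_{(0,1)}(\mathbb C^n,\tau p)\to L^2(\mathbb C^n,\sigma p)$$ to $\overline\partial$ is a Hilbert–Schmidt operator.
   Context: $\langle z,w\rangle=\sum_j z_j\overline w_j$ and $d\lambda$ is Lebesgue measure on $\mathbb C^n$. For $\sigma>0$, $L^2(\mathbb C^n,\sigma p)$ is the space of measurable $u$ with $\int_{\mathbb C^n}|u(z)|^2e^{-2\sigma p(z)}d\lambda(z)<\infty$, and $A^2(\mathbb C^n,\sigma p)$ is its closed subspace of entire functions. $A^2_{(0,1)}(\mathbb C^n,\tau p)$ is the Hilbert space of $(0,1)$-forms $f=\sum_{j=1}^n f_j\,d\overline z_j$ with all $f_j\in A^2(\mathbb C^n,\tau p)$, with norm $\|f\|^2=\sum_j\int|f_j|^2e^{-2\tau p}d\lambda$ (such forms are $\overline\partial$-closed). The canonical solution operator $S_1$ assigns to such $f$ the unique $u\in L^2(\mathbb C^n,\sigma p)$ with $\overline\partial u=f$ and $u\perp A^2(\mathbb C^n,\sigma p)$ in $L^2(\mathbb C^n,\sigma p)$. *)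

theory Defs
  imports "HOL-Analysis.Analysis"
begin

definition cinner :: "complex^'n \<Rightarrow> complex^'n \<Rightarrow> complex" where
  "cinner z w = (\<Sum>j\<in>UNIV. z $ j * cnj (w $ j))"

definition plurisubharmonic :: "(complex^'n \<Rightarrow> real) \<Rightarrow> bool" where
  "plurisubharmonic p \<longleftrightarrow>
     (\<forall>t. open {z. p z < t}) \<and>
     (\<forall>a b. set_integrable lborel {0..2*pi} (\<lambda>\<theta>. p (a + cis \<theta> *s b)) \<and>
            p a \<le> (LINT \<theta>:{0..2*pi}|lborel. p (a + cis \<theta> *s b)) / (2*pi))"

definition legendre_conj :: "(complex^'n \<Rightarrow> real) \<Rightarrow> complex^'n \<Rightarrow> ereal" where
  "legendre_conj p w = (SUP z. ereal (Re (cinner z w) - p z))"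

definition ptilde :: "(complex^'n \<Rightarrow> real) \<Rightarrow> complex^'n \<Rightarrow> real" where
  "ptilde p z = (SUP \<zeta>\<in>cball 0 1. p (z + \<zeta>))"

definition entire :: "(complex^'n \<Rightarrow> complex) \<Rightarrow> bool" where
  "entire f \<longleftrightarrow> (\<forall>z. \<exists>L. (f has_derivative L) (at z) \<and> (\<forall>c h. L (c *s h) = c * L h))"

definition wnorm2 :: "(complex^'n \<Rightarrow> real) \<Rightarrow> real \<Rightarrow> (complex^'n \<Rightarrow> complex) \<Rightarrow> ennreal" where
  "wnorm2 p s u = (\<integral>\<^sup>+ z. ennreal ((cmod (u z))^2 * exp (-2 * s * p z)) \<partial>lebesgue)"

definition winner :: "(complex^'n \<Rightarrow> real) \<Rightarrow> real \<Rightarrow> (complex^'n \<Rightarrow> complex) \<Rightarrow> (complex^'n \<Rightarrow> complex) \<Rightarrow> complex" where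
  "winner p s u v = (\<integral> z. u z * cnj (v z) * of_real (exp (-2 * s * p z)) \<partial>lebesgue)"

definition L2w :: "(complex^'n \<Rightarrow> real) \<Rightarrow> real \<Rightarrow> (complex^'n \<Rightarrow> complex) set" where
  "L2w p s = {u. u \<in> borel_measurable lebesgue \<and> wnorm2 p s u < \<infinity>}"

definition A2w :: "(complex^'n \<Rightarrow> real) \<Rightarrow> real \<Rightarrow> (complex^'n \<Rightarrow> complex) set" where
  "A2w p s = {u. u \<in> L2w p s \<and> entire u}"

text \<open>(0,1)-forms f = sum_j f_j d zbar_j, represented by their coefficient functions f j.\<close>
definition A2forms :: "(complex^'n \<Rightarrow> real) \<Rightarrow> real \<Rightarrow> ('n \<Rightarrow> complex^'n \<Rightarrow> complex) set" where
  "A2forms p t = {f. \<forall>j. f j \<in> A2w p t}"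

definition form_inner :: "(complex^'n \<Rightarrow> real) \<Rightarrow> real \<Rightarrow> ('n \<Rightarrow> complex^'n \<Rightarrow> complex) \<Rightarrow> ('n \<Rightarrow> complex^'n \<Rightarrow> complex) \<Rightarrow> complex" where
  "form_inner p t f g = (\<Sum>j\<in>UNIV. winner p t (f j) (g j))"

definition form_norm2 :: "(complex^'n \<Rightarrow> real) \<Rightarrow> real \<Rightarrow> ('n \<Rightarrow> complex^'n \<Rightarrow> complex) \<Rightarrow> ennreal" where
  "form_norm2 p t f = (\<Sum>j\<in>UNIV. wnorm2 p t (f j))"

text \<open>Smooth (C^infinity) functions: all iterated real directional derivatives exist everywhere.\<close>
definition smooth_fun :: "(complex^'n \<Rightarrow> complex) \<Rightarrow> bool" where
  "smooth_fun \<phi> \<longleftrightarrow> (\<exists>D. \<phi> \<in> D \<and>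
      (\<forall>g\<in>D. (\<forall>z. g differentiable (at z)) \<and> (\<forall>v. (\<lambda>z. frechet_derivative g (at z) v) \<in> D)))"

definition test_fun :: "(complex^'n \<Rightarrow> complex) \<Rightarrow> bool" where
  "test_fun \<phi> \<longleftrightarrow> smooth_fun \<phi> \<and> compact (closure {z. \<phi> z \<noteq> 0})"

definition dbar_j :: "'n \<Rightarrow> (complex^'n \<Rightarrow> complex) \<Rightarrow> complex^'n \<Rightarrow> complex" where
  "dbar_j j \<phi> z = (frechet_derivative \<phi> (at z) (axis j 1)
                    + \<i> * frechet_derivative \<phi> (at z) (axis j \<i>)) / 2"

definition weak_dbar :: "(complex^'n \<Rightarrow> complex) \<Rightarrow> ('n \<Rightarrow> complex^'n \<Rightarrow> complex) \<Rightarrow> bool" where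
  "weak_dbar u f \<longleftrightarrow> (\<forall>j \<phi>. test_fun \<phi> \<longrightarrow>
      (\<integral> z. u z * dbar_j j \<phi> z \<partial>lebesgue) = - (\<integral> z. f j z * \<phi> z \<partial>lebesgue))"

definition canonical_solution :: "(complex^'n \<Rightarrow> real) \<Rightarrow> real \<Rightarrow> ('n \<Rightarrow> complex^'n \<Rightarrow> complex) \<Rightarrow> (complex^'n \<Rightarrow> complex) \<Rightarrow> bool" where
  "canonical_solution p s f u \<longleftrightarrow> u \<in> L2w p s \<and> weak_dbar u f \<and> (\<forall>h\<in>A2w p s. winner p s u h = 0)"

definition form_onb :: "(complex^'n \<Rightarrow> real) \<Rightarrow> real \<Rightarrow> ('n \<Rightarrow> complex^'n \<Rightarrow> complex) set \<Rightarrow> bool" where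
  "form_onb p t B \<longleftrightarrow> B \<subseteq> A2forms p t \<and>
     (\<forall>b\<in>B. \<forall>b'\<in>B. form_inner p t b b' = (if b = b' then 1 else 0)) \<and>
     (\<forall>f\<in>A2forms p t. (\<forall>b\<in>B. form_inner p t f b = 0) \<longrightarrow> form_norm2 p t f = 0)"

text \<open>S : A^2_(0,1)(t p) -> L^2(s p) is Hilbert-Schmidt: sum over an orthonormal basis of
||S b||^2 is finite (unordered sum of nonnegative terms = sup of finite partial sums).\<close>
definition hilbert_schmidt :: "(complex^'n \<Rightarrow> real) \<Rightarrow> real \<Rightarrow> real \<Rightarrow> (('n \<Rightarrow> complex^'n \<Rightarrow> complex) \<Rightarrow> (complex^'n \<Rightarrow> complex)) \<Rightarrow> bool" where
  "hilbert_schmidt p t s S \<longleftrightarrow> (\<exists>B. form_onb p t B \<and> (SUP F\<in>{F. finite F \<and> F \<subseteq> B}. \<Sum>b\<in>F. wnorm2 p s (S b)) < \<infinity>)"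

end

theory Submission
  imports Defs "HOL-Complex_Analysis.Complex_Analysis" "HOL-Real_Asymp.Real_Asymp"
begin

text \<open>If the coefficients \<open>f k\<close> are entire, then \<open>u z = (\<Sum>k. f k z * cnj (z $ k))\<close> solves the
  d-bar equation, so the canonical solution is \<open>u\<close> minus its orthogonal projection and its norm is
  at most that of \<open>u\<close>. The sub-mean value property on unit balls bounds the Bergman kernel of
  \<open>A2w p \<tau>\<close> on the diagonal by a multiple of \<open>exp (2 * \<tau> * ptilde p z)\<close>. Hence the Hilbert-Schmidt
  norm is controlled by the integral of \<open>(norm z)\<^sup>2 * exp (2 * \<tau> * ptilde p z - 2 * \<sigma> * p z)\<close>. For every
  \<open>\<tau> < \<sigma>\<close> this integrand decays exponentially: \<open>ptilde p\<close> is asymptotic to \<open>p\<close>, and finiteness of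
  the Legendre conjugate forces \<open>p\<close> to grow at least linearly.\<close>

section \<open>Uniqueness of Lebesgue measure and the sub-mean value property\<close>

text \<open>Three points carry the argument. Averaging circle means over the complex lines through a
  point gives the sub-mean value property on balls only if Lebesgue measure is invariant under
  unimodular scalars; this is derived from the uniqueness of translation invariant measures. The
  projection onto \<open>A2w p \<sigma>\<close> exists because \<open>p\<close> is bounded above on
  compact sets: point evaluations are then bounded uniformly on each ball, so a sequence of entire
  functions that is Cauchy in the weighted norm converges locally uniformly, and the limit is again
  entire. Finally, for a finite orthonormal family the sum of \<open>(cmod (b j z))^2\<close> is at
  most the bound for the squared norm of evaluation at \<open>z\<close>, whatever the family; hence
  all partial sums in \<open>hilbert_schmidt\<close> share one bound, and a basis produced by Zorn's
  lemma is good enough. Pairing with the conjugate coordinates costs a factor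
  \<open>(norm z)^2\<close>, which the gap between \<tau> and \<sigma> pays for.\<close>

lemma nn_integral_lborel_translate:
  fixes f :: "'a::euclidean_space \<Rightarrow> ennreal"
  assumes [measurable]: "f \<in> borel_measurable borel"
  shows "(\<integral>\<^sup>+x. f (c + x) \<partial>lborel) = (\<integral>\<^sup>+x. f x \<partial>lborel)"
proof -
  have "(\<integral>\<^sup>+x. f x \<partial>lborel) = (\<integral>\<^sup>+x. f x \<partial>distr lborel borel ((+) c))"
    by (simp add: lborel_distr_plus)
  also have "\<dots> = (\<integral>\<^sup>+x. f (c + x) \<partial>lborel)"
    by (subst nn_integral_distr) auto
  finally show ?thesis ..
qed

lemma nn_integral_lborel_reflect:
  fixes f :: "'a::euclidean_space \<Rightarrow> ennreal"
  assumes [measurable]: "f \<in> borel_measurable borel"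
  shows "(\<integral>\<^sup>+x. f (c - x) \<partial>lborel) = (\<integral>\<^sup>+x. f x \<partial>lborel)"
proof -
  have "(lborel :: 'a measure) = distr lborel borel (\<lambda>x. c + (-1) *\<^sub>R x)"
    by (subst lborel_affine[of "-1" c]) (auto simp: density_1)
  then have "(\<integral>\<^sup>+x. f x \<partial>lborel) = (\<integral>\<^sup>+x. f x \<partial>distr lborel borel (\<lambda>x. c + (-1) *\<^sub>R x))"
    by simp
  also have "\<dots> = (\<integral>\<^sup>+x. f (c - x) \<partial>lborel)"
    by (subst nn_integral_distr) auto
  finally show ?thesis ..
qed

text \<open>Uniqueness of Haar measure: evaluate the double integral of
  \<open>indicator A x * indicator B (x + y)\<close> in both orders.\<close>

lemma translation_invariant_eq_lborel:
  fixes M :: "'a::euclidean_space measure"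
  assumes [measurable_cong]: "sets M = sets borel" and sf: "sigma_finite_measure M"
    and inv: "\<And>c. distr M borel ((+) c) = M"
    and ball: "emeasure M (ball 0 1) = emeasure lborel (ball (0::'a) 1)"
  shows "M = lborel"
proof (rule measure_eqI)
  fix A assume "A \<in> sets M"
  then have [measurable]: "A \<in> sets borel" using assms(1) by simp
  let ?B = "ball (0::'a) 1"
  have [measurable]: "?B \<in> sets borel" by (intro borel_open open_ball)
  interpret M: sigma_finite_measure M by (rule sf)
  interpret P: pair_sigma_finite M lborel ..
  have trans: "(\<integral>\<^sup>+x. f (c + x) \<partial>M) = (\<integral>\<^sup>+x. f x \<partial>M)"
    if [measurable]: "f \<in> borel_measurable borel" for f :: "'a \<Rightarrow> ennreal" and c
  proof -
    have "(\<integral>\<^sup>+x. f x \<partial>M) = (\<integral>\<^sup>+x. f x \<partial>distr M borel ((+) c))"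
      by (simp add: inv)
    also have "\<dots> = (\<integral>\<^sup>+x. f (c + x) \<partial>M)"
      by (subst nn_integral_distr) auto
    finally show ?thesis ..
  qed
  have "emeasure M A * emeasure lborel ?B
      = (\<integral>\<^sup>+x. indicator A x * (\<integral>\<^sup>+y. indicator ?B y \<partial>lborel) \<partial>M)"
    by (simp add: nn_integral_multc)
  also have "\<dots> = (\<integral>\<^sup>+x. (\<integral>\<^sup>+y. indicator A x * indicator ?B (x + y) \<partial>lborel) \<partial>M)"
  proof (rule nn_integral_cong)
    fix x
    have "(\<integral>\<^sup>+y. indicator ?B (x + y) \<partial>lborel) = (\<integral>\<^sup>+y. indicator ?B y \<partial>lborel)"
      by (rule nn_integral_lborel_translate) measurable
    then show "indicator A x * (\<integral>\<^sup>+y. indicator ?B y \<partial>lborel)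
        = (\<integral>\<^sup>+y. indicator A x * indicator ?B (x + y) \<partial>lborel)"
      by (subst nn_integral_cmult) auto
  qed
  also have "\<dots> = (\<integral>\<^sup>+y. (\<integral>\<^sup>+x. indicator A x * indicator ?B (x + y) \<partial>M) \<partial>lborel)"
    by (rule P.Fubini'[symmetric]) measurable
  \<comment> \<open>Invariance of \<open>M\<close> moves the shift by \<open>y\<close> from
    \<open>?B\<close> to \<open>A\<close>. After the integrals are swapped back, the reflection
    \<open>y\<close> to \<open>x - y\<close> makes the inner integral equal to
    \<open>emeasure lborel A\<close> for every \<open>x\<close> in \<open>?B\<close>.\<close>
  also have "\<dots> = (\<integral>\<^sup>+y. (\<integral>\<^sup>+x. indicator A (x - y) * indicator ?B x \<partial>M) \<partial>lborel)"
  proof (rule nn_integral_cong)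
    fix y :: 'a
    have "(\<integral>\<^sup>+x. indicator A (- y + x) * indicator ?B ((- y + x) + y) \<partial>M)
        = (\<integral>\<^sup>+x. indicator A x * indicator ?B (x + y) \<partial>M)"
      by (rule trans) measurable
    then show "(\<integral>\<^sup>+x. indicator A x * indicator ?B (x + y) \<partial>M)
        = (\<integral>\<^sup>+x. indicator A (x - y) * indicator ?B x \<partial>M)"
      by simp
  qed
  also have "\<dots> = (\<integral>\<^sup>+x. (\<integral>\<^sup>+y. indicator A (x - y) * indicator ?B x \<partial>lborel) \<partial>M)"
    by (rule P.Fubini') measurable
  also have "\<dots> = (\<integral>\<^sup>+x. emeasure lborel A * indicator ?B x \<partial>M)"
  proof (rule nn_integral_cong)
    fix x
    have "(\<integral>\<^sup>+y. indicator A (x - y) \<partial>lborel) = (\<integral>\<^sup>+y. indicator A y \<partial>lborel)"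
      by (rule nn_integral_lborel_reflect) measurable
    then show "(\<integral>\<^sup>+y. indicator A (x - y) * indicator ?B x \<partial>lborel)
        = emeasure lborel A * indicator ?B x"
      by (subst nn_integral_multc) auto
  qed
  also have "\<dots> = emeasure lborel A * emeasure lborel ?B"
    by (simp add: nn_integral_cmult ball)
  finally have *: "emeasure M A * emeasure lborel ?B = emeasure lborel A * emeasure lborel ?B" .
  \<comment> \<open>The common factor can be cancelled because the unit ball has finite and positive
    volume.\<close>
  have "emeasure lborel ?B \<noteq> \<infinity>" using emeasure_lborel_ball_finite[of 0 1] by (auto simp: less_top)
  moreover have "emeasure lborel ?B \<noteq> 0"
    using emeasure_ball[of 1 "0::'a"] by (simp add: unit_ball_vol_pos less_imp_neq[symmetric])
  ultimately show "emeasure M A = emeasure lborel A"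
    using * by (metis ennreal_mult_divide_eq infinity_ennreal_def)
qed (use assms in auto)

text \<open>The image measure is again translation invariant, since
  \<open>c + T x = T (S c + x)\<close> for the inverse \<open>S\<close>, and it gives the unit ball
  its old mass because \<open>T\<close> preserves norms. Uniqueness does the rest. It is applied to
  multiplication by \<open>exp (2 * pi * \<i> * t)\<close>.\<close>

lemma lborel_distr_linear_isometry:
  fixes T :: "'a::euclidean_space \<Rightarrow> 'a"
  assumes lin: "linear T" and nT: "\<And>x. norm (T x) = norm x"
  shows "distr lborel borel T = lborel"
proof -
  have contT: "continuous_on UNIV T" using lin by (simp add: linear_continuous_on linear_conv_bounded_linear)
  then have [measurable]: "T \<in> borel_measurable borel" by (rule borel_measurable_continuous_onI)
  have inj: "inj T" using lin nT by (metis linear_injective_0 norm_eq_zero)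
  have surj: "surj T" using lin inj by (rule linear_inj_imp_surj)
  define S where "S = inv T"
  have TS: "T (S x) = x" and ST: "S (T x) = x" for x
    unfolding S_def using surj inj by (simp_all add: surj_f_inv_f)
  have nS: "norm (S x) = norm x" for x by (metis TS nT)
  show ?thesis
  proof (rule translation_invariant_eq_lborel)
    have "sigma_finite_measure (distr lborel borel T)"
    proof (rule sigma_finite_measure.intro, intro exI conjI)
      let ?A = "range (\<lambda>n::nat. cball (0::'a) n)"
      show "countable ?A" by auto
      show "?A \<subseteq> sets (distr lborel borel T)" by auto
      show "\<Union> ?A = space (distr lborel borel T)" using real_arch_simple by auto
      show "\<forall>a\<in>?A. emeasure (distr lborel borel T) a \<noteq> \<infinity>"
      proof
        fix a assume "a \<in> ?A"
        then obtain n :: nat where a: "a = cball 0 n" by auto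
        have "T -` a = cball 0 n" unfolding a by (auto simp: nT)
        then show "emeasure (distr lborel borel T) a \<noteq> \<infinity>"
          using emeasure_lborel_cball_finite[of "0::'a" n] a
          by (subst emeasure_distr) (auto simp: less_top)
      qed
    qed
    then show "sigma_finite_measure (distr lborel borel T)" .
    show "distr (distr lborel borel T) borel ((+) c) = distr lborel borel T" for c
    proof -
      have "distr (distr lborel borel T) borel ((+) c) = distr lborel borel ((+) c \<circ> T)"
        by (rule distr_distr) auto
      also have "(+) c \<circ> T = T \<circ> (+) (S c)"
        using lin by (auto simp: fun_eq_iff linear_add TS)
      also have "distr lborel borel (T \<circ> (+) (S c)) = distr (distr lborel borel ((+) (S c))) borel T"
        by (rule distr_distr[symmetric]) auto
      finally show ?thesis by (simp add: lborel_distr_plus)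
    qed
    have "T -` ball 0 1 = ball 0 1" by (auto simp: nT)
    then show "emeasure (distr lborel borel T) (ball 0 1) = emeasure lborel (ball (0::'a) 1)"
      by (subst emeasure_distr) auto
  qed simp
qed

section \<open>Entire functions on complex lines: Cauchy estimates and means\<close>

lemma norm_vector_scalar_mult: "norm (c *s (v::complex^'n)) = cmod c * norm v"
  by (simp add: norm_vec_def norm_mult L2_set_right_distrib)

lemma vector_scalar_mult_scaleR: "(r *\<^sub>R (c::complex)) *s (v::complex^'n) = r *\<^sub>R (c *s v)"
  by (simp add: vec_eq_iff)

lemma linear_vector_scalar_mult_right: "linear (\<lambda>v. c *s (v::complex^'n))"
  by (rule linearI) (simp_all add: vec_eq_iff algebra_simps)

lemma bounded_linear_vector_scalar_mult_left: "bounded_linear (\<lambda>c. c *s (v::complex^'n))"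
  by (rule bounded_linear_intro[where K="norm v"])
    (simp_all add: vector_sadd_rdistrib vector_scalar_mult_scaleR norm_vector_scalar_mult)

lemma continuous_on_vector_scalar_mult [continuous_intros]:
  fixes g :: "'a::topological_space \<Rightarrow> complex^'n"
  assumes "continuous_on A f" "continuous_on A g"
  shows "continuous_on A (\<lambda>x. f x *s g x)"
  unfolding vector_scalar_mult_def using assms
  by (intro continuous_on_vec_lambda continuous_on_mult continuous_on_component)

lemma entire_has_derivative:
  assumes "entire f"
  shows "(f has_derivative frechet_derivative f (at z)) (at z)"
    and "frechet_derivative f (at z) (c *s v) = c * frechet_derivative f (at z) v"
proof -
  obtain L where L: "(f has_derivative L) (at z)" "\<forall>c h. L (c *s h) = c * L h"
    using assms unfolding entire_def by blast
  then have "frechet_derivative f (at z) = L" by (metis frechet_derivative_at)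
  with L show "(f has_derivative frechet_derivative f (at z)) (at z)"
    "frechet_derivative f (at z) (c *s v) = c * frechet_derivative f (at z) v" by auto
qed

lemma entire_continuous_on: "entire f \<Longrightarrow> continuous_on A f"
  by (meson continuous_at_imp_continuous_on entire_has_derivative(1) has_derivative_continuous)

lemma entire_slice_field_derivative:
  assumes "entire f"
  shows "((\<lambda>c. f (z + c *s v)) has_field_derivative frechet_derivative f (at (z + c *s v)) v) (at c)"
proof -
  have "((\<lambda>c. z + c *s v) has_derivative (\<lambda>c. c *s v)) (at c)"
    using bounded_linear_imp_has_derivative[OF bounded_linear_vector_scalar_mult_left, of v]
    by (auto intro!: derivative_eq_intros)
  then have "((\<lambda>c. f (z + c *s v)) has_derivative
      (\<lambda>d. frechet_derivative f (at (z + c *s v)) (d *s v))) (at c)"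
    by (rule has_derivative_compose) (rule entire_has_derivative[OF assms])
  then show ?thesis
    unfolding has_field_derivative_def entire_has_derivative(2)[OF assms]
    by (rule has_derivative_eq_rhs) (simp add: fun_eq_iff mult.commute)
qed

lemma entire_slice_holomorphic: "entire f \<Longrightarrow> (\<lambda>c. f (z + c *s v)) holomorphic_on A"
  unfolding holomorphic_on_def field_differentiable_def
  using entire_slice_field_derivative has_field_derivative_at_within by blast

text \<open>Cauchy's estimate on the unit circle of the complex line through \<open>z\<close> in the
  direction of \<open>v\<close>; complex homogeneity of the derivative then restores the length of
  \<open>v\<close>.\<close>

lemma entire_derivative_bound:
  assumes f: "entire f" and B: "\<And>w. w \<in> cball z 1 \<Longrightarrow> cmod (f w) \<le> B"
  shows "cmod (frechet_derivative f (at z) v) \<le> B * norm v"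
proof (cases "v = 0")
  case True
  then show ?thesis using entire_has_derivative(2)[OF f, of z 0 v] by simp
next
  case False
  define w where "w = inverse (norm v) *\<^sub>R v"
  have nw: "norm w = 1" using False by (simp add: w_def)
  have v: "v = complex_of_real (norm v) *s w"
    using False by (simp add: w_def vec_eq_iff scaleR_conv_of_real[where 'a=complex])
  let ?g = "\<lambda>c. f (z + c *s w)"
  have "norm ((deriv ^^ 1) ?g 0) \<le> fact 1 * B / 1 ^ 1"
  proof (rule Cauchy_inequality)
    show "?g holomorphic_on ball 0 1" by (rule entire_slice_holomorphic[OF f])
    show "continuous_on (cball 0 1) ?g"
      by (rule holomorphic_on_imp_continuous_on, rule entire_slice_holomorphic[OF f])
    show "cmod (?g x) \<le> B" if "norm (0 - x) = 1" for x
      using that by (intro B) (simp add: dist_norm norm_vector_scalar_mult nw)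
  qed simp
  moreover have "deriv ?g 0 = frechet_derivative f (at z) w"
    using entire_slice_field_derivative[OF f, of z w 0] by (simp add: DERIV_imp_deriv)
  ultimately have "cmod (frechet_derivative f (at z) w) \<le> B" by simp
  moreover have "cmod (frechet_derivative f (at z) v) = cmod (frechet_derivative f (at z) w) * norm v"
    by (subst v, subst entire_has_derivative(2)[OF f]) (simp add: norm_mult)
  ultimately show ?thesis by (simp add: mult_right_mono)
qed

text \<open>Cauchy's formula at the centre of the unit circle: the velocity of the parametrisation
  cancels the kernel \<open>1 / u\<close> up to the factor \<open>2 * pi * \<i>\<close>. The
  conclusion is in \<open>ennreal\<close> so that Tonelli applies to it directly.\<close>

lemma holomorphic_norm_le_circle_mean:
  assumes hol: "F holomorphic_on UNIV"
  shows "ennreal (cmod (F 0)) \<le> (\<integral>\<^sup>+t. indicator {0..1::real} t * ennreal (cmod (F (exp (2 * of_real pi * \<i> * of_real t)))) \<partial>lborel)"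
proof -
  let ?e = "\<lambda>t::real. exp (2 * of_real pi * \<i> * of_real t) :: complex"
  have contF: "continuous_on A F" for A
    using hol holomorphic_on_imp_continuous_on continuous_on_subset by blast
  have "((\<lambda>u. F u / (u - 0)) has_contour_integral (2 * of_real pi * \<i> * F 0)) (circlepath 0 1)"
    by (rule Cauchy_integral_circlepath) (use contF hol holomorphic_on_subset in auto)
  then have "((\<lambda>t. F (?e t) / ?e t * (2 * of_real pi * \<i> * ?e t)) has_integral (2 * of_real pi * \<i> * F 0)) {0..1}"
    unfolding has_contour_integral vector_derivative_circlepath unfolding circlepath by simp
  then have "((\<lambda>t. inverse (2 * of_real pi * \<i>) * (F (?e t) / ?e t * (2 * of_real pi * \<i> * ?e t))) has_integral
      (inverse (2 * of_real pi * \<i>) * (2 * of_real pi * \<i> * F 0))) {0..1}"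
    by (rule has_integral_mult_right)
  then have hi: "((\<lambda>t. F (?e t)) has_integral F 0) {0..1}" by (simp add: field_simps)
  have cont: "continuous_on {0..1} (\<lambda>t. F (?e t))"
    by (rule continuous_on_compose2[OF contF[of UNIV]]) (auto intro!: continuous_intros)
  then have si: "set_integrable lborel {0..1} (\<lambda>t. F (?e t))"
    by (intro borel_integrable_atLeastAtMost') 
  have "F 0 = (LINT t:{0..1}|lborel. F (?e t))"
    using set_borel_integral_eq_integral(2)[OF si] hi by (simp add: integral_unique)
  also have "ennreal (cmod \<dots>) \<le> (\<integral>\<^sup>+t. ennreal (cmod (indicator {0..1::real} t *\<^sub>R F (?e t))) \<partial>lborel)"
    using si unfolding set_integrable_def set_lebesgue_integral_def by (rule integral_norm_bound_ennreal)
  also have "\<dots> = (\<integral>\<^sup>+t. indicator {0..1::real} t * ennreal (cmod (F (?e t))) \<partial>lborel)"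
    by (intro nn_integral_cong) (auto simp: indicator_def)
  finally show ?thesis .
qed

text \<open>For each direction \<zeta> in the unit ball the value at the centre is bounded by the
  mean over the circle \<open>z + exp (2 * pi * \<i> * t) *s \<zeta>\<close>. Integrating over
  \<zeta> and exchanging the integrals, the rotation disappears for each fixed \<open>t\<close>,
  since it preserves both the ball and the measure.\<close>

lemma entire_submean:
  assumes f: "entire (f :: complex^'n \<Rightarrow> complex)"
  shows "emeasure lborel (cball (0::complex^'n) 1) * ennreal ((cmod (f z))\<^sup>2)
     \<le> (\<integral>\<^sup>+w. indicator (cball z 1) w * ennreal ((cmod (f w))\<^sup>2) \<partial>lborel)"
proof -
  let ?e = "\<lambda>t::real. exp (2 * of_real pi * \<i> * of_real t) :: complex"
  let ?B = "cball (0::complex^'n) 1"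
  have [measurable]: "cball c 1 \<in> sets borel" for c :: "complex^'n" by (intro borel_closed closed_cball)
  have cf: "continuous_on A f" for A using f by (rule entire_continuous_on)
  have [measurable]: "f \<in> borel_measurable borel"
    using cf by (rule borel_measurable_continuous_onI)
  have ne: "cmod (?e t) = 1" for t by (simp add: norm_exp_eq_Re)
  have [measurable]: "(\<lambda>(\<zeta>::complex^'n, t). ?e t *s \<zeta>) \<in> borel_measurable (borel \<Otimes>\<^sub>M borel)"
    unfolding borel_prod by (intro borel_measurable_continuous_onI) (auto simp: case_prod_unfold intro!: continuous_intros)
  have "emeasure lborel ?B * ennreal ((cmod (f z))\<^sup>2)
      = (\<integral>\<^sup>+\<zeta>. indicator ?B \<zeta> * ennreal ((cmod (f z))\<^sup>2) \<partial>lborel)"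
    by (subst nn_integral_multc) auto
  also have "\<dots> \<le> (\<integral>\<^sup>+\<zeta>. (\<integral>\<^sup>+t. indicator {0..1::real} t * (indicator ?B (?e t *s \<zeta>) * ennreal ((cmod (f (z + ?e t *s \<zeta>)))\<^sup>2)) \<partial>lborel) \<partial>lborel)"
  proof (rule nn_integral_mono)
    fix \<zeta> :: "complex^'n"
    \<comment> \<open>The mean value inequality is applied to the square, itself holomorphic, so it
      bounds the squared modulus directly.\<close>
    have "(\<lambda>c. (f (z + c *s \<zeta>))\<^sup>2) holomorphic_on UNIV"
      by (intro holomorphic_on_power entire_slice_holomorphic f)
    from holomorphic_norm_le_circle_mean[OF this]
    show "indicator ?B \<zeta> * ennreal ((cmod (f z))\<^sup>2) \<le> (\<integral>\<^sup>+t. indicator {0..1::real} t * (indicator ?B (?e t *s \<zeta>) * ennreal ((cmod (f (z + ?e t *s \<zeta>)))\<^sup>2)) \<partial>lborel)"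
      by (auto simp: indicator_def norm_vector_scalar_mult ne norm_power)
  qed
  also have "\<dots> = (\<integral>\<^sup>+t. (\<integral>\<^sup>+\<zeta>. indicator {0..1::real} t * (indicator ?B (?e t *s \<zeta>) * ennreal ((cmod (f (z + ?e t *s \<zeta>)))\<^sup>2)) \<partial>lborel) \<partial>lborel)"
    by (rule lborel_pair.Fubini'[symmetric]) measurable
  also have "\<dots> = (\<integral>\<^sup>+t. indicator {0..1::real} t * (\<integral>\<^sup>+\<zeta>. indicator ?B \<zeta> * ennreal ((cmod (f (z + \<zeta>)))\<^sup>2) \<partial>lborel) \<partial>lborel)"
  proof (rule nn_integral_cong)
    fix t :: real
    have m: "(\<lambda>\<zeta>. ?e t *s (\<zeta>::complex^'n)) \<in> borel_measurable borel"
      by (intro borel_measurable_continuous_onI continuous_intros)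
    have "(\<integral>\<^sup>+\<zeta>. indicator ?B \<zeta> * ennreal ((cmod (f (z + \<zeta>)))\<^sup>2) \<partial>lborel)
       = (\<integral>\<^sup>+\<zeta>. indicator ?B \<zeta> * ennreal ((cmod (f (z + \<zeta>)))\<^sup>2) \<partial>distr lborel borel (\<lambda>\<zeta>. ?e t *s \<zeta>))"
      by (subst lborel_distr_linear_isometry) (auto simp: linear_vector_scalar_mult_right norm_vector_scalar_mult ne)
    also have "\<dots> = (\<integral>\<^sup>+\<zeta>. indicator ?B (?e t *s \<zeta>) * ennreal ((cmod (f (z + ?e t *s \<zeta>)))\<^sup>2) \<partial>lborel)"
      using m by (subst nn_integral_distr) auto
    finally show "(\<integral>\<^sup>+\<zeta>. indicator {0..1::real} t * (indicator ?B (?e t *s \<zeta>) * ennreal ((cmod (f (z + ?e t *s \<zeta>)))\<^sup>2)) \<partial>lborel)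
       = indicator {0..1::real} t * (\<integral>\<^sup>+\<zeta>. indicator ?B \<zeta> * ennreal ((cmod (f (z + \<zeta>)))\<^sup>2) \<partial>lborel)"
      using m by (subst nn_integral_cmult) auto
  qed
  also have "\<dots> = (\<integral>\<^sup>+\<zeta>. indicator ?B \<zeta> * ennreal ((cmod (f (z + \<zeta>)))\<^sup>2) \<partial>lborel)"
    by (subst nn_integral_multc) auto
  also have "\<dots> = (\<integral>\<^sup>+\<zeta>. indicator (cball z 1) (z + \<zeta>) * ennreal ((cmod (f (z + \<zeta>)))\<^sup>2) \<partial>lborel)"
    by (intro nn_integral_cong) (auto simp: indicator_def dist_norm)
  also have "\<dots> = (\<integral>\<^sup>+w. indicator (cball z 1) w * ennreal ((cmod (f w))\<^sup>2) \<partial>lborel)"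
    by (rule nn_integral_lborel_translate) measurable
  finally show ?thesis .
qed

section \<open>Square integrable functions and orthogonal projection\<close>

text \<open>A predicate on actual functions rather than on classes modulo null sets, so that entire
  functions form a subspace literally and pointwise limits make sense.\<close>

definition sq_integrable :: "'a measure \<Rightarrow> ('a \<Rightarrow> complex) \<Rightarrow> bool" where
  "sq_integrable M u \<longleftrightarrow> u \<in> borel_measurable M \<and> integrable M (\<lambda>x. (cmod (u x))\<^sup>2)"

lemma norm_add_square_le: "(cmod (a + b))\<^sup>2 \<le> 2 * (cmod a)\<^sup>2 + 2 * (cmod b)\<^sup>2"
proof -
  have "(cmod (a + b))\<^sup>2 \<le> (cmod a + cmod b)\<^sup>2" by (intro power_mono norm_triangle_ineq) simp
  also have "\<dots> \<le> 2 * (cmod a)\<^sup>2 + 2 * (cmod b)\<^sup>2"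
    using sum_squares_bound[of "cmod a" "cmod b"] by (simp add: power2_sum)
  finally show ?thesis .
qed

lemma sq_integrable_zero: "sq_integrable M (\<lambda>x. 0)"
  by (simp add: sq_integrable_def)

lemma sq_integrable_add:
  assumes "sq_integrable M u" "sq_integrable M v"
  shows "sq_integrable M (\<lambda>x. u x + v x)"
proof -
  have [measurable]: "u \<in> borel_measurable M" "v \<in> borel_measurable M"
    using assms by (auto simp: sq_integrable_def)
  have "integrable M (\<lambda>x. 2 * (cmod (u x))\<^sup>2 + 2 * (cmod (v x))\<^sup>2)"
    using assms by (auto simp: sq_integrable_def)
  then have "integrable M (\<lambda>x. (cmod (u x + v x))\<^sup>2)"
    by (rule Bochner_Integration.integrable_bound) (auto simp: norm_add_square_le)
  then show ?thesis by (simp add: sq_integrable_def)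
qed

lemma sq_integrable_cmult: "sq_integrable M u \<Longrightarrow> sq_integrable M (\<lambda>x. c * u x)"
  by (auto simp: sq_integrable_def norm_mult power_mult_distrib)

lemma sq_integrable_diff:
  "sq_integrable M u \<Longrightarrow> sq_integrable M v \<Longrightarrow> sq_integrable M (\<lambda>x. u x - v x)"
  using sq_integrable_add[of M u "\<lambda>x. -1 * v x"] sq_integrable_cmult[of M v "-1"] by simp

lemma sq_integrable_sum:
  assumes "finite A" "\<And>i. i \<in> A \<Longrightarrow> sq_integrable M (u i)"
  shows "sq_integrable M (\<lambda>x. \<Sum>i\<in>A. u i x)"
  using assms by (induction A rule: finite_induct) (auto intro: sq_integrable_zero sq_integrable_add)

lemma integrable_mult_cnj:
  assumes "sq_integrable M u" "sq_integrable M v"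
  shows "integrable M (\<lambda>x. u x * cnj (v x))"
proof -
  have [measurable]: "u \<in> borel_measurable M" "v \<in> borel_measurable M"
    using assms by (auto simp: sq_integrable_def)
  have [measurable]: "cnj \<in> borel_measurable borel"
    by (intro borel_measurable_continuous_onI continuous_intros)
  have "integrable M (\<lambda>x. (cmod (u x))\<^sup>2 + (cmod (v x))\<^sup>2)"
    using assms by (auto simp: sq_integrable_def)
  then show ?thesis
  proof (rule Bochner_Integration.integrable_bound)
    have "cmod a * cmod b \<le> (cmod a)\<^sup>2 + (cmod b)\<^sup>2" for a b
      using sum_squares_bound[of "cmod a" "cmod b"] mult_nonneg_nonneg[OF norm_ge_zero norm_ge_zero, of a b]
      unfolding mult.assoc by linarith
    then show "AE x in M. cmod (u x * cnj (v x)) \<le> norm ((cmod (u x))\<^sup>2 + (cmod (v x))\<^sup>2)"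
      by (auto simp: norm_mult)
  qed measurable
qed

definition l2_inner :: "'a measure \<Rightarrow> ('a \<Rightarrow> complex) \<Rightarrow> ('a \<Rightarrow> complex) \<Rightarrow> complex" where
  "l2_inner M u v = (\<integral>x. u x * cnj (v x) \<partial>M)"

definition l2_norm2 :: "'a measure \<Rightarrow> ('a \<Rightarrow> complex) \<Rightarrow> real" where
  "l2_norm2 M u = (\<integral>x. (cmod (u x))\<^sup>2 \<partial>M)"

lemma l2_norm2_nonneg: "l2_norm2 M u \<ge> 0"
  by (simp add: l2_norm2_def)

lemma l2_inner_self: "l2_inner M u u = of_real (l2_norm2 M u)"
  unfolding l2_inner_def l2_norm2_def integral_complex_of_real[symmetric]
  by (intro Bochner_Integration.integral_cong) (simp_all add: complex_norm_square[symmetric])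

lemma l2_inner_commute: "l2_inner M v u = cnj (l2_inner M u v)"
  unfolding l2_inner_def by (simp flip: Bochner_Integration.integral_cnj add: mult.commute)

lemma l2_inner_cmult_left: "l2_inner M (\<lambda>x. c * u x) v = c * l2_inner M u v"
  by (simp add: l2_inner_def mult.assoc)

lemma l2_norm2_cmult: "l2_norm2 M (\<lambda>x. c * u x) = (cmod c)\<^sup>2 * l2_norm2 M u"
  by (simp add: l2_norm2_def norm_mult power_mult_distrib)

lemma l2_inner_sum_sum:
  assumes "finite A" "\<And>i. i \<in> A \<Longrightarrow> sq_integrable M (u i)"
  shows "l2_inner M (\<lambda>x. \<Sum>i\<in>A. a i * u i x) (\<lambda>x. \<Sum>i\<in>A. a i * u i x)
     = (\<Sum>i\<in>A. \<Sum>k\<in>A. a i * cnj (a k) * l2_inner M (u i) (u k))"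
proof -
  have int: "integrable M (\<lambda>x. (a i * cnj (a k)) * (u i x * cnj (u k x)))" if "i \<in> A" "k \<in> A" for i k
    by (intro integrable_mult_right integrable_mult_cnj assms that)
  have "l2_inner M (\<lambda>x. \<Sum>i\<in>A. a i * u i x) (\<lambda>x. \<Sum>i\<in>A. a i * u i x)
      = (\<integral>x. (\<Sum>i\<in>A. \<Sum>k\<in>A. (a i * cnj (a k)) * (u i x * cnj (u k x))) \<partial>M)"
    unfolding l2_inner_def
    by (intro Bochner_Integration.integral_cong) (auto simp: cnj_sum sum_product mult_ac)
  also have "\<dots> = (\<Sum>i\<in>A. \<Sum>k\<in>A. (\<integral>x. (a i * cnj (a k)) * (u i x * cnj (u k x)) \<partial>M))"
    by (subst Bochner_Integration.integral_sum; (intro Bochner_Integration.integrable_sum int sum.cong refl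
        Bochner_Integration.integral_sum)?)
  finally show ?thesis by (simp add: l2_inner_def)
qed

lemma norm_diff_cmult_square:
  "(cmod (a - c * b))\<^sup>2 = (cmod a)\<^sup>2 - 2 * Re (cnj c * (a * cnj b)) + (cmod c)\<^sup>2 * (cmod b)\<^sup>2"
  unfolding cmod_power2 by (simp add: power2_eq_square algebra_simps)

text \<open>One expansion for two uses: \<open>c = 1\<close> and \<open>c = - 1\<close> give the
  parallelogram law, and a free \<open>c\<close> gives the variation that proves orthogonality of
  the projection remainder.\<close>

lemma l2_norm2_diff_cmult:
  assumes u: "sq_integrable M u" and v: "sq_integrable M v"
  shows "l2_norm2 M (\<lambda>x. u x - c * v x)
     = l2_norm2 M u - 2 * Re (cnj c * l2_inner M u v) + (cmod c)\<^sup>2 * l2_norm2 M v"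
proof -
  have i: "integrable M (\<lambda>x. cnj c * (u x * cnj (v x)))"
    by (intro integrable_mult_right integrable_mult_cnj u v)
  have "l2_norm2 M (\<lambda>x. u x - c * v x)
      = (\<integral>x. ((cmod (u x))\<^sup>2 - 2 * Re (cnj c * (u x * cnj (v x)))) + (cmod c)\<^sup>2 * (cmod (v x))\<^sup>2 \<partial>M)"
    unfolding l2_norm2_def by (simp only: norm_diff_cmult_square)
  also have "\<dots> = l2_norm2 M u - 2 * Re (\<integral>x. cnj c * (u x * cnj (v x)) \<partial>M) + (cmod c)\<^sup>2 * l2_norm2 M v"
    unfolding l2_norm2_def integral_Re[OF i, symmetric]
    using u v integrable_Re[OF i]
    by (subst Bochner_Integration.integral_add Bochner_Integration.integral_diff;
      (subst Bochner_Integration.integral_diff)?; simp only: sq_integrable_def integral_mult_right_zero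
        integrable_mult_right Bochner_Integration.integrable_diff)
  finally show ?thesis by (simp add: l2_inner_def)
qed

text \<open>Written with the midpoint because the squared distance to a subspace bounds exactly that
  term from below.\<close>

lemma l2_parallelogram:
  assumes u: "sq_integrable M u" and v: "sq_integrable M v"
  shows "l2_norm2 M (\<lambda>x. u x - v x)
     = 2 * l2_norm2 M u + 2 * l2_norm2 M v - 4 * l2_norm2 M (\<lambda>x. (u x + v x) / 2)"
proof -
  have "l2_norm2 M (\<lambda>x. (u x + v x) / 2) = l2_norm2 M (\<lambda>x. (1/2) * (u x - (- 1) * v x))"
    by simp
  also have "\<dots> = 1/4 * l2_norm2 M (\<lambda>x. u x - (- 1) * v x)"
    by (subst l2_norm2_cmult) (simp add: norm_divide power2_eq_square)
  finally show ?thesis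
    using l2_norm2_diff_cmult[OF u v, of 1] l2_norm2_diff_cmult[OF u v, of "- 1"] by simp
qed

lemma nn_integral_eq_l2_norm2:
  "sq_integrable M u \<Longrightarrow> (\<integral>\<^sup>+x. ennreal ((cmod (u x))\<^sup>2) \<partial>M) = ennreal (l2_norm2 M u)"
  unfolding l2_norm2_def by (rule nn_integral_eq_integral) (auto simp: sq_integrable_def)

text \<open>Lower semicontinuity of the norm under pointwise convergence; finiteness of the limit
  \<open>d\<close> also yields the integrability of \<open>h\<close>.\<close>

lemma l2_fatou:
  assumes X: "\<And>n. sq_integrable M (X n)" and lim: "\<And>x. (\<lambda>n. X n x) \<longlonglongrightarrow> h x"
    and bd: "(\<lambda>n. l2_norm2 M (X n)) \<longlonglongrightarrow> d"
  shows "sq_integrable M h" "l2_norm2 M h \<le> d"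
proof -
  have [measurable]: "X n \<in> borel_measurable M" for n using X by (simp add: sq_integrable_def)
  have [measurable]: "h \<in> borel_measurable M"
    by (rule borel_measurable_LIMSEQ_metric[of X]) (use lim in auto)
  have d: "d \<ge> 0" using bd by (rule LIMSEQ_le_const) (auto simp: l2_norm2_nonneg)
  have "(\<integral>\<^sup>+x. ennreal ((cmod (h x))\<^sup>2) \<partial>M)
      = (\<integral>\<^sup>+x. liminf (\<lambda>n. ennreal ((cmod (X n x))\<^sup>2)) \<partial>M)"
    by (intro nn_integral_cong lim_imp_Liminf[symmetric])
       (auto intro!: tendsto_ennrealI tendsto_intros lim)
  also have "\<dots> \<le> liminf (\<lambda>n. (\<integral>\<^sup>+x. ennreal ((cmod (X n x))\<^sup>2) \<partial>M))"
    by (rule nn_integral_liminf) measurable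
  also have "\<dots> = ennreal d"
    unfolding nn_integral_eq_l2_norm2[OF X]
    by (intro lim_imp_Liminf tendsto_ennrealI bd) simp
  finally have le: "(\<integral>\<^sup>+x. ennreal ((cmod (h x))\<^sup>2) \<partial>M) \<le> ennreal d" .
  then have "(\<integral>\<^sup>+x. ennreal ((cmod (h x))\<^sup>2) \<partial>M) < \<infinity>"
    by (rule le_less_trans) simp
  then show sq: "sq_integrable M h"
    unfolding sq_integrable_def by (auto intro!: integrableI_bounded)
  show "l2_norm2 M h \<le> d"
    using le d unfolding nn_integral_eq_l2_norm2[OF sq] by simp
qed

text \<open>Fatou's lemma makes the pointwise limit of a minimizing sequence a minimizer, so no
  completeness of the ambient \<open>L\<^sup>2\<close> space is involved.\<close>

lemma l2_projection_exists:
  assumes V: "\<And>h. h \<in> V \<Longrightarrow> sq_integrable M h"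
    and zero: "(\<lambda>x. 0) \<in> V"
    and add: "\<And>g h. g \<in> V \<Longrightarrow> h \<in> V \<Longrightarrow> (\<lambda>x. g x + h x) \<in> V"
    and cmult: "\<And>c h. h \<in> V \<Longrightarrow> (\<lambda>x. c * h x) \<in> V"
    and closed: "\<And>X. (\<And>n. X n \<in> V) \<Longrightarrow>
       (\<And>e. e > 0 \<Longrightarrow> \<exists>N. \<forall>m\<ge>N. \<forall>n\<ge>N. l2_norm2 M (\<lambda>x. X m x - X n x) < e) \<Longrightarrow>
       \<exists>h. (\<forall>x. (\<lambda>n. X n x) \<longlonglongrightarrow> h x) \<and> (sq_integrable M h \<longrightarrow> h \<in> V)"
    and u: "sq_integrable M u"
  obtains h where "h \<in> V" "\<And>g. g \<in> V \<Longrightarrow> l2_inner M (\<lambda>x. u x - h x) g = 0"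
    "l2_norm2 M (\<lambda>x. u x - h x) \<le> l2_norm2 M u"
proof -
  define N where "N h = l2_norm2 M (\<lambda>x. u x - h x)" for h
  define d where "d = Inf (N ` V)"
  have bdd: "bdd_below (N ` V)" by (rule bdd_belowI[of _ 0]) (auto simp: N_def l2_norm2_nonneg)
  have dle: "d \<le> N h" if "h \<in> V" for h unfolding d_def using that bdd by (intro cInf_lower) auto
  have "\<exists>h\<in>V. N h < d + inverse (Suc n)" for n
  proof -
    have "d < d + inverse (Suc n)" by simp
    then show ?thesis using cInf_less_iff[of "N ` V" "d + inverse (Suc n)"] bdd zero unfolding d_def by blast
  qed
  then obtain X where XV: "\<And>n. X n \<in> V" and XN: "\<And>n. N (X n) < d + inverse (Suc n)" by metis
  have sqd: "sq_integrable M (\<lambda>x. u x - X n x)" for n by (intro sq_integrable_diff u V XV)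
  \<comment> \<open>The midpoint of \<open>X m\<close> and \<open>X n\<close> lies in
    \<open>V\<close>, so the parallelogram law leaves at most
    \<open>2 * N (X m) + 2 * N (X n) - 4 * d\<close>, in which \<open>d\<close> cancels.\<close>
  have key: "l2_norm2 M (\<lambda>x. X m x - X n x) < 2 * inverse (Suc m) + 2 * inverse (Suc n)" for m n
  proof -
    have "(\<lambda>x. (1/2) * (X m x + X n x)) \<in> V" by (intro cmult add XV)
    then have "d \<le> N (\<lambda>x. (1/2) * (X m x + X n x))" by (rule dle)
    moreover have "N (\<lambda>x. (1/2) * (X m x + X n x)) = l2_norm2 M (\<lambda>x. ((u x - X m x) + (u x - X n x)) / 2)"
      unfolding N_def by (rule arg_cong[where f="l2_norm2 M"]) (simp add: fun_eq_iff field_simps)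
    moreover have "l2_norm2 M (\<lambda>x. X m x - X n x) = l2_norm2 M (\<lambda>x. (u x - X m x) - (u x - X n x))"
      by (simp add: l2_norm2_def norm_minus_commute)
    ultimately show ?thesis
      using l2_parallelogram[OF sqd[of m] sqd[of n]] XN[of m] XN[of n] unfolding N_def by linarith
  qed
  have "\<exists>N. \<forall>m\<ge>N. \<forall>n\<ge>N. l2_norm2 M (\<lambda>x. X m x - X n x) < e" if "e > 0" for e
  proof -
    obtain N where N: "inverse (real (Suc N)) < e / 4" using reals_Archimedean[of "e/4"] \<open>e > 0\<close> by auto
    have "l2_norm2 M (\<lambda>x. X m x - X n x) < e" if "m \<ge> N" "n \<ge> N" for m n
    proof -
      have "inverse (real (Suc m)) \<le> inverse (real (Suc N))" "inverse (real (Suc n)) \<le> inverse (real (Suc N))"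
        using that by (auto intro!: le_imp_inverse_le)
      then show ?thesis using key[of m n] N by linarith
    qed
    then show ?thesis by blast
  qed
  from closed[OF XV this] obtain h where h: "\<And>x. (\<lambda>n. X n x) \<longlonglongrightarrow> h x" and hV: "sq_integrable M h \<Longrightarrow> h \<in> V"
    by blast
  have "(\<lambda>n. N (X n)) \<longlonglongrightarrow> d"
  proof (rule tendsto_sandwich[where f="\<lambda>_. d" and h="\<lambda>n. d + inverse (Suc n)"])
    show "(\<lambda>n. d + inverse (real (Suc n))) \<longlonglongrightarrow> d"
      using tendsto_add[OF tendsto_const LIMSEQ_inverse_real_of_nat, of d] by simp
    show "eventually (\<lambda>n. N (X n) \<le> d + inverse (Suc n)) sequentially"
      using XN less_imp_le by (intro always_eventually) blast
  qed (use dle XV in auto)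
  then have lim: "(\<lambda>n. l2_norm2 M (\<lambda>x. u x - X n x)) \<longlonglongrightarrow> d" unfolding N_def .
  have lim2: "(\<lambda>n. u x - X n x) \<longlonglongrightarrow> u x - h x" for x by (intro tendsto_intros h)
  \<comment> \<open>Fatou is applied to \<open>u - X n\<close>, whose squared norms tend to
    \<open>d\<close>. Then \<open>h = u - (u - h)\<close> is square integrable, which is the
    condition under which \<open>closed\<close> places \<open>h\<close> in \<open>V\<close>.\<close>
  have sq: "sq_integrable M (\<lambda>x. u x - h x)" and Nd: "l2_norm2 M (\<lambda>x. u x - h x) \<le> d"
    using l2_fatou[OF sqd lim2 lim] by auto
  have "sq_integrable M h" using sq_integrable_diff[OF u sq] by simp
  then have hinV: "h \<in> V" by (rule hV)
  show thesis
  proof (rule that[OF hinV])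
    have "d \<le> l2_norm2 M u" using dle[OF zero] by (simp add: N_def)
    then show "l2_norm2 M (\<lambda>x. u x - h x) \<le> l2_norm2 M u" using Nd by simp
  next
    fix g assume g: "g \<in> V"
    let ?a = "l2_inner M (\<lambda>x. u x - h x) g"
    let ?G = "l2_norm2 M g"
    have *: "2 * Re (cnj c * ?a) \<le> (cmod c)\<^sup>2 * ?G" for c
    proof -
      have "(\<lambda>x. h x + c * g x) \<in> V" by (intro add cmult hinV g)
      then have "d \<le> N (\<lambda>x. h x + c * g x)" by (rule dle)
      also have "\<dots> = l2_norm2 M (\<lambda>x. (u x - h x) - c * g x)" by (simp add: N_def diff_diff_eq)
      also have "\<dots> = l2_norm2 M (\<lambda>x. u x - h x) - 2 * Re (cnj c * ?a) + (cmod c)\<^sup>2 * ?G"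
        by (rule l2_norm2_diff_cmult[OF sq V[OF g]])
      finally show ?thesis using Nd by simp
    qed
    show "?a = 0"
    proof (rule ccontr)
      assume "?a \<noteq> 0"
      then have a: "(cmod ?a)\<^sup>2 > 0" by simp
      \<comment> \<open>The variation \<open>c = t * ?a\<close> gives
        \<open>2 * t * (cmod ?a)^2 \<le> t^2 * (cmod ?a)^2 * ?G\<close>, impossible once
        \<open>t * ?G < 1\<close>. The summand \<open>1\<close> keeps \<open>t\<close> well defined
        when \<open>?G = 0\<close>.\<close>
      define t where "t = inverse (1 + ?G)"
      have G: "?G \<ge> 0" by (rule l2_norm2_nonneg)
      then have t: "t > 0" "t * ?G < 1" unfolding t_def by (simp_all add: field_simps)
      have "Re (cnj (of_real t * ?a) * ?a) = t * (cmod ?a)\<^sup>2"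
        unfolding cmod_power2 by (simp add: algebra_simps power2_eq_square)
      then have "2 * (t * (cmod ?a)\<^sup>2) \<le> (t\<^sup>2 * (cmod ?a)\<^sup>2) * ?G"
        using *[of "of_real t * ?a"] by (simp add: norm_mult power_mult_distrib)
      also have "\<dots> = (t * ?G) * (t * (cmod ?a)\<^sup>2)" by (simp add: power2_eq_square)
      also have "\<dots> \<le> 1 * (t * (cmod ?a)\<^sup>2)" using t a by (intro mult_right_mono) auto
      finally show False using mult_pos_pos[OF t(1) a] by linarith
    qed
  qed
qed

section \<open>Limits of entire functions\<close>

lemma entire_const: "entire (\<lambda>z. c)"
  unfolding entire_def by (intro allI exI[of _ "\<lambda>_. 0"]) simp

lemma entire_add:
  assumes "entire f" "entire g"
  shows "entire (\<lambda>z. f z + g z)"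
  unfolding entire_def
proof
  fix z
  obtain F G where "(f has_derivative F) (at z)" "\<forall>c h. F (c *s h) = c * F h"
    "(g has_derivative G) (at z)" "\<forall>c h. G (c *s h) = c * G h"
    using assms unfolding entire_def by blast
  then show "\<exists>L. ((\<lambda>z. f z + g z) has_derivative L) (at z) \<and> (\<forall>c h. L (c *s h) = c * L h)"
    by (intro exI[of _ "\<lambda>h. F h + G h"]) (auto intro!: has_derivative_add simp: algebra_simps)
qed

lemma entire_cmult:
  assumes "entire f"
  shows "entire (\<lambda>z. c * f z)"
  unfolding entire_def
proof
  fix z
  obtain F where "(f has_derivative F) (at z)" "\<forall>c h. F (c *s h) = c * F h"
    using assms unfolding entire_def by blast
  then show "\<exists>L. ((\<lambda>z. c * f z) has_derivative L) (at z) \<and> (\<forall>c h. L (c *s h) = c * L h)"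
    by (intro exI[of _ "\<lambda>h. c * F h"]) (auto intro!: has_derivative_mult_right)
qed

lemma entire_diff: "entire f \<Longrightarrow> entire g \<Longrightarrow> entire (\<lambda>z. f z - g z)"
  using entire_add[of f "\<lambda>z. -1 * g z"] entire_cmult[of g "-1"] by simp

lemma entire_sum:
  assumes "finite A" "\<And>i. i \<in> A \<Longrightarrow> entire (f i)"
  shows "entire (\<lambda>z. \<Sum>i\<in>A. f i z)"
  using assms by (induction A rule: finite_induct) (auto intro: entire_const entire_add)

lemma entire_borel_measurable: "entire f \<Longrightarrow> f \<in> borel_measurable borel"
  by (rule borel_measurable_continuous_onI) (rule entire_continuous_on)

text \<open>Weierstrass' theorem in several variables. Cauchy's estimate turns uniform convergence
  on balls into uniform convergence of the derivatives, so the limit is differentiable, and complex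
  homogeneity of the derivatives survives pointwise limits.\<close>

lemma entire_limit_exists:
  fixes X :: "nat \<Rightarrow> complex^'n \<Rightarrow> complex"
  assumes ent: "\<And>n. entire (X n)"
    and cau: "\<And>R e. e > 0 \<Longrightarrow> \<exists>N. \<forall>m\<ge>N. \<forall>n\<ge>N. \<forall>z\<in>cball 0 R. cmod (X m z - X n z) \<le> e"
  obtains h where "\<And>z. (\<lambda>n. X n z) \<longlonglongrightarrow> h z" "entire h"
proof -
  have "Cauchy (\<lambda>n. X n z)" for z
  proof (rule CauchyI)
    fix e :: real assume "0 < e"
    then obtain N where "\<forall>m\<ge>N. \<forall>n\<ge>N. \<forall>z\<in>cball 0 (norm z). cmod (X m z - X n z) \<le> e/2"
      using cau[of "e/2" "norm z"] by auto
    then have "\<forall>m\<ge>N. \<forall>n\<ge>N. cmod (X m z - X n z) \<le> e/2" by simp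
    moreover have "e / 2 < e" using \<open>0 < e\<close> by simp
    ultimately show "\<exists>N. \<forall>m\<ge>N. \<forall>n\<ge>N. norm (X m z - X n z) < e"
      by (meson le_less_trans)
  qed
  then obtain h where h: "\<And>z. (\<lambda>n. X n z) \<longlonglongrightarrow> h z"
    unfolding Cauchy_convergent_iff convergent_def by metis
  define L where "L n z = frechet_derivative (X n) (at z)" for n z
  have L: "(X n has_derivative L n z) (at z)" for n z unfolding L_def by (rule entire_has_derivative[OF ent])
  have Lc: "L n z (c *s v) = c * L n z v" for n z c v unfolding L_def by (rule entire_has_derivative[OF ent])
  \<comment> \<open>The derivative at \<open>z\<close> is controlled by values on
    \<open>cball z 1\<close>, hence the enlarged radius \<open>R + 1\<close>.\<close>
  have cauL: "\<exists>N. \<forall>m\<ge>N. \<forall>n\<ge>N. \<forall>z\<in>cball 0 R. \<forall>v. cmod (L m z v - L n z v) \<le> e * norm v" if e: "e > 0" for R e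
  proof -
    obtain N where N: "\<forall>m\<ge>N. \<forall>n\<ge>N. \<forall>z\<in>cball 0 (R+1). cmod (X m z - X n z) \<le> e" using cau[OF e] by blast
    have "cmod (L m z v - L n z v) \<le> e * norm v" if "m \<ge> N" "n \<ge> N" "z \<in> cball 0 R" for m n z v
    proof -
      have "((\<lambda>z. X m z - X n z) has_derivative (\<lambda>v. L m z v - L n z v)) (at z)"
        by (intro has_derivative_diff L)
      then have "frechet_derivative (\<lambda>z. X m z - X n z) (at z) = (\<lambda>v. L m z v - L n z v)"
        by (rule frechet_derivative_at[symmetric])
      moreover have "cmod (frechet_derivative (\<lambda>z. X m z - X n z) (at z) v) \<le> e * norm v"
      proof (rule entire_derivative_bound)
        show "entire (\<lambda>z. X m z - X n z)" by (intro entire_diff ent)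
        fix w assume "w \<in> cball z 1"
        then have "w \<in> cball 0 (R+1)" using that(3) norm_triangle_ineq2[of w z] by (auto simp: dist_norm norm_minus_commute)
        then show "cmod (X m w - X n w) \<le> e" using N that by blast
      qed
      ultimately show ?thesis by simp
    qed
    then show ?thesis by blast
  qed
  have "Cauchy (\<lambda>n. L n z v)" for z v
  proof (rule CauchyI)
    fix e :: real assume "0 < e"
    then have e': "e / 2 / (1 + norm v) > 0" by (simp add: add_pos_nonneg)
    obtain N where N: "\<forall>m\<ge>N. \<forall>n\<ge>N. \<forall>z\<in>cball 0 (norm z). \<forall>v'. cmod (L m z v' - L n z v') \<le> e / 2 / (1 + norm v) * norm v'"
      using cauL[OF e', of "norm z"] by blast
    have "e / 2 / (1 + norm v) * norm v < e"
    proof -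
      have "norm v / (1 + norm v) \<le> 1" by (simp add: divide_le_eq add_pos_nonneg)
      then have "e / 2 * (norm v / (1 + norm v)) \<le> e / 2 * 1" using \<open>0 < e\<close> by (intro mult_left_mono) auto
      moreover have "e / 2 / (1 + norm v) * norm v = e / 2 * (norm v / (1 + norm v))"
        by (simp only: times_divide_eq_left times_divide_eq_right divide_divide_eq_left)
      ultimately show ?thesis using \<open>0 < e\<close> by linarith
    qed
    moreover have "\<forall>m\<ge>N. \<forall>n\<ge>N. cmod (L m z v - L n z v) \<le> e / 2 / (1 + norm v) * norm v"
      using N by (auto simp del: times_divide_eq_left)
    ultimately show "\<exists>N. \<forall>m\<ge>N. \<forall>n\<ge>N. norm (L m z v - L n z v) < e"
      by (meson le_less_trans)
  qed
  then have "\<forall>z v. \<exists>l. (\<lambda>n. L n z v) \<longlonglongrightarrow> l" unfolding Cauchy_convergent_iff convergent_def by blast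
  then obtain g where g: "\<And>z v. (\<lambda>n. L n z v) \<longlonglongrightarrow> g z v" by metis
  have gc: "g z (c *s v) = c * g z v" for z c v
  proof (rule LIMSEQ_unique)
    show "(\<lambda>n. L n z (c *s v)) \<longlonglongrightarrow> g z (c *s v)" by (rule g)
    show "(\<lambda>n. L n z (c *s v)) \<longlonglongrightarrow> c * g z v" unfolding Lc by (intro tendsto_intros g)
  qed
  have der: "(h has_derivative g z) (at z)" for z
  proof -
    define S where "S = ball (0::complex^'n) (norm z + 1)"
    have zS: "z \<in> S" and oS: "open S" unfolding S_def by auto
    have "\<exists>k. \<forall>x\<in>S. (\<lambda>n. X n x) \<longlonglongrightarrow> k x \<and> (k has_derivative g x) (at x within S)"
    proof (rule has_derivative_sequence)
      show "convex S" unfolding S_def by simp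
      show "(X n has_derivative L n x) (at x within S)" for n x by (rule has_derivative_at_withinI[OF L])
      show "z \<in> S" "(\<lambda>n. X n z) \<longlonglongrightarrow> h z" by (rule zS, rule h)
      fix e :: real assume "e > 0"
      then obtain N where N: "\<forall>m\<ge>N. \<forall>n\<ge>N. \<forall>z\<in>cball 0 (norm z + 1). \<forall>v. cmod (L m z v - L n z v) \<le> e * norm v"
        using cauL by blast
      have "norm (L n x v - g x v) \<le> e * norm v" if "n \<ge> N" "x \<in> S" for n x v
      proof (rule LIMSEQ_le_const2)
        show "(\<lambda>m. norm (L n x v - L m x v)) \<longlonglongrightarrow> norm (L n x v - g x v)" by (intro tendsto_intros g)
        have "x \<in> cball 0 (norm z + 1)" using that(2) ball_subset_cball unfolding S_def by blast
        then show "\<exists>N. \<forall>m\<ge>N. norm (L n x v - L m x v) \<le> e * norm v" using N that(1) by blast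
      qed
      then show "\<forall>\<^sub>F n in sequentially. \<forall>x\<in>S. \<forall>v. norm (L n x v - g x v) \<le> e * norm v"
        unfolding eventually_sequentially by blast
    qed
    then obtain k where k: "\<And>x. x \<in> S \<Longrightarrow> (\<lambda>n. X n x) \<longlonglongrightarrow> k x" "\<And>x. x \<in> S \<Longrightarrow> (k has_derivative g x) (at x within S)"
      by blast
    have "k x = h x" if "x \<in> S" for x using LIMSEQ_unique[OF k(1)[OF that] h] .
    moreover have "(k has_derivative g z) (at z)" using k(2)[OF zS] at_within_open[OF zS oS] by simp
    ultimately show ?thesis using has_derivative_transform_within_open oS zS by blast
  qed
  show thesis
    using that[OF h] der gc unfolding entire_def by blast
qed

section \<open>Weights and their growth\<close>

text \<open>Half of the exponent absorbs the polynomial, and the other half is a geometric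
  series.\<close>

lemma summable_power_mult_exp:
  assumes "b > 0"
  shows "summable (\<lambda>k::nat. real (k + 1) ^ D * exp (- b * real k))"
proof (rule summable_comparison_test_bigo)
  show "summable (\<lambda>k. norm (exp (- (b / 2)) ^ k))"
    using assms by (simp add: summable_geometric_iff)
  have "(\<lambda>k::nat. real (k + 1) ^ D * exp (- b * real k)) \<in> O(\<lambda>k. exp (- (b / 2) * real k))"
    using assms by real_asymp
  then show "(\<lambda>k::nat. real (k + 1) ^ D * exp (- b * real k)) \<in> O(\<lambda>k. exp (- (b / 2)) ^ k)"
    by (simp add: exp_of_nat_mult[symmetric] mult.commute)
qed

text \<open>With \<open>k\<close> the integer part of \<open>norm z\<close>, the integrand is at
  most \<open>exp (- b * k)\<close> and \<open>z\<close> lies in the ball of radius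
  \<open>k + 1\<close>. Ball volumes grow only polynomially, so the resulting series
  converges.\<close>

lemma nn_integral_exp_norm_finite:
  assumes b: "b > 0"
  shows "(\<integral>\<^sup>+z. ennreal (exp (- b * norm (z::'a::euclidean_space))) \<partial>lborel) < \<infinity>"
proof -
  let ?V = "unit_ball_vol (DIM('a))"
  have [measurable]: "cball (0::'a) r \<in> sets borel" for r by (intro borel_closed closed_cball)
  have "(\<integral>\<^sup>+z. ennreal (exp (- b * norm (z::'a))) \<partial>lborel)
      \<le> (\<integral>\<^sup>+z. (\<Sum>k. ennreal (exp (- b * real k)) * indicator (cball (0::'a) (real (k + 1))) z) \<partial>lborel)"
  proof (rule nn_integral_mono)
    fix z :: 'a
    define k where "k = nat \<lfloor>norm z\<rfloor>"
    have k: "real k \<le> norm z" "norm z \<le> real (k + 1)" 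
      using floor_correct[of "norm z"] unfolding k_def by (simp_all add: add.commute)
    have "ennreal (exp (- b * norm z)) \<le> ennreal (exp (- b * real k)) * indicator (cball 0 (real (k + 1))) z"
      using k b by (auto intro!: ennreal_leI)
    also have "\<dots> \<le> (\<Sum>k. ennreal (exp (- b * real k)) * indicator (cball 0 (real (k + 1))) z)"
    proof -
      have "T k \<le> suminf T" for T :: "nat \<Rightarrow> ennreal"
        using sum_le_suminf[OF summableI, of "{k}" T] by simp
      then show ?thesis .
    qed
    finally show "ennreal (exp (- b * norm z)) \<le> (\<Sum>k. ennreal (exp (- b * real k)) * indicator (cball 0 (real (k + 1))) z)" .
  qed
  also have "\<dots> = (\<Sum>k. (\<integral>\<^sup>+z. ennreal (exp (- b * real k)) * indicator (cball (0::'a) (real (k + 1))) z \<partial>lborel))"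
    by (rule nn_integral_suminf) measurable
  also have "\<dots> = (\<Sum>k. ennreal (?V * (real (k + 1) ^ DIM('a) * exp (- b * real k))))"
  proof (rule suminf_cong)
    fix k
    have "(\<integral>\<^sup>+z. ennreal (exp (- b * real k)) * indicator (cball (0::'a) (real (k + 1))) z \<partial>lborel)
        = ennreal (exp (- b * real k)) * emeasure lborel (cball (0::'a) (real (k + 1)))"
      by (rule nn_integral_cmult_indicator) auto
    also have "\<dots> = ennreal (exp (- b * real k) * (?V * real (k + 1) ^ DIM('a)))"
      by (subst emeasure_cball) (auto simp: ennreal_mult)
    finally show "(\<integral>\<^sup>+z. ennreal (exp (- b * real k)) * indicator (cball (0::'a) (real (k + 1))) z \<partial>lborel)
      = ennreal (?V * (real (k + 1) ^ DIM('a) * exp (- b * real k)))" by (simp only: mult_ac)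
  qed
  also have "\<dots> = ennreal (\<Sum>k. ?V * (real (k + 1) ^ DIM('a) * exp (- b * real k)))"
  proof (rule suminf_ennreal2)
    show "summable (\<lambda>k. ?V * (real (k + 1) ^ DIM('a) * exp (- b * real k)))"
      by (intro summable_mult summable_power_mult_exp b)
  qed simp
  finally show ?thesis by (rule le_less_trans) simp
qed

text \<open>Half of the exponent pays for the quadratic factor: \<open>t^2 / 2 \<le> exp t\<close>
  at \<open>t = a / 2 * norm z\<close> produces the constant \<open>8 / a^2\<close>.\<close>

lemma nn_integral_norm_square_exp_finite:
  assumes a: "a > 0"
  shows "(\<integral>\<^sup>+z. ennreal ((norm z)\<^sup>2 * exp (- a * norm (z::'a::euclidean_space))) \<partial>lborel) < \<infinity>"
proof -
  have "(\<integral>\<^sup>+z. ennreal ((norm z)\<^sup>2 * exp (- a * norm (z::'a))) \<partial>lborel)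
      \<le> (\<integral>\<^sup>+z. ennreal (8 / a\<^sup>2) * ennreal (exp (- (a/2) * norm (z::'a))) \<partial>lborel)"
  proof (rule nn_integral_mono)
    fix z :: 'a
    let ?t = "a / 2 * norm z"
    have "?t\<^sup>2 / 2 \<le> exp ?t" 
    proof -
      have "0 \<le> ?t" using a by simp
      with exp_lower_Taylor_quadratic[OF this] show ?thesis by linarith
    qed
    then have "?t\<^sup>2 / 2 * exp (- a * norm z) \<le> exp ?t * exp (- a * norm z)"
      by (rule mult_right_mono) simp
    also have "\<dots> = exp (- (a/2) * norm z)" by (simp add: exp_add[symmetric])
    finally have "(norm z)\<^sup>2 * exp (- a * norm z) \<le> 8 / a\<^sup>2 * exp (- (a/2) * norm z)"
      using a by (simp add: field_simps power2_eq_square)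
    then show "ennreal ((norm z)\<^sup>2 * exp (- a * norm z)) \<le> ennreal (8 / a\<^sup>2) * ennreal (exp (- (a/2) * norm z))"
      by (simp add: ennreal_mult[symmetric] ennreal_leI)
  qed
  also have "\<dots> = ennreal (8 / a\<^sup>2) * (\<integral>\<^sup>+z. ennreal (exp (- (a/2) * norm (z::'a))) \<partial>lborel)"
    by (rule nn_integral_cmult) measurable
  also have "\<dots> < \<infinity>"
    using nn_integral_exp_norm_finite[of "a/2", where 'a='a] a by (simp add: ennreal_mult_less_top)
  finally show ?thesis .
qed

section \<open>Plurisubharmonic weights: local upper bounds and linear growth\<close>

lemma Re_cinner: "Re (cinner z w) = z \<bullet> w"
  by (simp add: cinner_def inner_vec_def inner_complex_def)

lemma plurisubharmonic_borel_measurable: "plurisubharmonic p \<Longrightarrow> p \<in> borel_measurable borel"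
  unfolding plurisubharmonic_def by (intro borel_measurableI_less) auto

text \<open>Upper semicontinuity makes the sets \<open>{z. p z < n}\<close> an open cover of the
  compact ball.\<close>

lemma plurisubharmonic_bounded_above:
  fixes p :: "complex^'n \<Rightarrow> real"
  assumes "plurisubharmonic p"
  obtains m where "\<And>w. w \<in> cball 0 R \<Longrightarrow> p w \<le> m"
proof -
  have "compact (cball (0::complex^'n) R)" by simp
  moreover have "cball 0 R \<subseteq> (\<Union>n::nat. {z. p z < real n})" using reals_Archimedean2 by auto
  ultimately obtain N :: "nat set" where N: "finite N" "cball 0 R \<subseteq> (\<Union>n\<in>N. {z. p z < real n})"
    using assms unfolding plurisubharmonic_def
    by (elim compactE_image[where C=UNIV]) auto
  \<comment> \<open>The sum of a finite set of naturals replaces its maximum and is also defined for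
    empty \<open>N\<close>.\<close>
  have "p w \<le> real (\<Sum>N)" if w: "w \<in> cball 0 R" for w
  proof -
    obtain n where n: "n \<in> N" "p w < real n" using N w by blast
    have "n \<le> \<Sum>N" using N n by (intro member_le_sum[of n N "\<lambda>x. x", simplified]) auto
    then show ?thesis using n by linarith
  qed
  then show thesis by (rule that)
qed

text \<open>The supremum in \<open>ptilde\<close> is taken in the reals, so it is an upper bound
  only once \<open>p\<close> is known to be bounded above on the ball.\<close>

lemma le_ptilde:
  fixes p :: "complex^'n \<Rightarrow> real"
  assumes psh: "plurisubharmonic p" and w: "w \<in> cball z 1"
  shows "p w \<le> ptilde p z"
proof -
  obtain m where m: "\<And>w. w \<in> cball 0 (norm z + 1) \<Longrightarrow> p w \<le> m"
    using plurisubharmonic_bounded_above[OF psh] by metis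
  have "bdd_above ((\<lambda>\<zeta>. p (z + \<zeta>)) ` cball 0 1)"
  proof (rule bdd_aboveI2)
    fix \<zeta> :: "complex^'n" assume "\<zeta> \<in> cball 0 1"
    then show "p (z + \<zeta>) \<le> m" using norm_triangle_ineq[of z \<zeta>] by (intro m) auto
  qed
  moreover have "w - z \<in> cball 0 1" using w by (simp add: dist_norm norm_minus_commute)
  ultimately have "p (z + (w - z)) \<le> (SUP \<zeta>\<in>cball 0 1. p (z + \<zeta>))" by (rule cSUP_upper[rotated])
  then show ?thesis by (simp add: ptilde_def)
qed

lemma ptilde_le:
  assumes "\<And>w. w \<in> cball z 1 \<Longrightarrow> p w \<le> m"
  shows "ptilde p z \<le> m"
  unfolding ptilde_def by (rule cSUP_least) (auto intro!: assms simp: dist_norm)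

text \<open>Finiteness of the conjugate at \<open>w\<close> is an affine minorant of
  \<open>p\<close> with slope \<open>w\<close>, because \<open>Re (cinner z w)\<close> is the real
  inner product. Taking \<open>w\<close> to be plus and minus each basis vector bounds every
  coordinate, and hence the norm through the l1 norm.\<close>

lemma legendre_conj_finite_growth:
  fixes p :: "complex^'n \<Rightarrow> real"
  assumes fin: "\<forall>w. legendre_conj p w < \<infinity>"
  obtains k C where "k > 0" "\<And>z. k * norm z - C \<le> p z"
proof -
  have ex: "\<exists>C. \<forall>z. z \<bullet> w - C \<le> p z" for w
  proof -
    have le: "ereal (Re (cinner z w) - p z) \<le> legendre_conj p w" for z
      unfolding legendre_conj_def by (rule SUP_upper) simp
    have "legendre_conj p w < \<infinity>" using fin by simp
    then obtain C where C: "legendre_conj p w \<le> ereal C"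
      by (cases "legendre_conj p w") auto
    have "z \<bullet> w - p z \<le> C" for z
      using order_trans[OF le C, of z] by (simp add: Re_cinner)
    then show ?thesis by (intro exI[of _ C]) (auto simp: algebra_simps)
  qed
  then obtain c where c: "\<And>w z. z \<bullet> w - c w \<le> p z" by metis
  \<comment> \<open>A single constant that dominates the intercepts of all these minorants at
    once.\<close>
  define K where "K = (\<Sum>b\<in>Basis. \<bar>c b\<bar> + \<bar>c (-b)\<bar>)"
  let ?D = "real DIM(complex^'n)"
  have "\<bar>z \<bullet> b\<bar> \<le> p z + K" if b: "b \<in> Basis" for b z
  proof -
    have "\<bar>c b\<bar> + \<bar>c (-b)\<bar> \<le> K" unfolding K_def
      using b by (intro member_le_sum) auto
    then have "\<bar>c b\<bar> \<le> K" "\<bar>c (-b)\<bar> \<le> K" by linarith+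
    moreover have "- (z \<bullet> b) - c (-b) \<le> p z" using c[of z "-b"] by simp
    ultimately show ?thesis using c[of z b] by linarith
  qed
  then have sum_le: "(\<Sum>b\<in>Basis. \<bar>z \<bullet> b\<bar>) \<le> (\<Sum>b\<in>(Basis::(complex^'n) set). p z + K)" for z
    by (intro sum_mono)
  have "norm z \<le> ?D * (p z + K)" for z
    using order_trans[OF norm_le_l1 sum_le[of z]] unfolding sum_constant .
  then have "(1 / ?D) * norm z - K \<le> p z" for z
    by (simp add: field_simps)
  then show thesis by (intro that[of "1 / ?D" K]) auto
qed

text \<open>Far from the origin the ratio \<open>ptilde p z / p z\<close> is close enough to 1 for
  the exponent to be a negative multiple of \<open>p z\<close>, which grows linearly. On the
  remaining ball, an upper bound for \<open>ptilde p\<close> and the linear lower bound for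
  \<open>p\<close> suffice, at the price of a larger constant.\<close>

lemma exp_ptilde_decay:
  fixes p :: "complex^'n \<Rightarrow> real"
  assumes psh: "plurisubharmonic p"
    and conj_finite: "\<forall>w. legendre_conj p w < \<infinity>"
    and tilde_lim: "((\<lambda>z. ptilde p z / p z) \<longlongrightarrow> 1) at_infinity"
    and \<tau>: "0 < \<tau>" "\<tau> < \<sigma>"
  obtains a C where "a > 0" "C > 0" "\<And>z. exp (2 * \<tau> * ptilde p z - 2 * \<sigma> * p z) \<le> C * exp (- a * norm z)"
proof -
  obtain k C0 where k: "k > 0" and pk: "\<And>z. k * norm z - C0 \<le> p z"
    using legendre_conj_finite_growth[OF conj_finite] by blast
  \<comment> \<open>Chosen so that \<open>\<tau> * q\<close> is the midpoint of \<tau> and \<sigma>: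
    then \<open>q > 1\<close>, and \<open>\<tau> * q - \<sigma>\<close> is still negative, namely
    \<open>- \<delta>\<close>.\<close>
  define q where "q = (\<sigma> + \<tau>) / (2 * \<tau>)"
  have q: "q > 1" "\<tau> * q = (\<sigma> + \<tau>) / 2" unfolding q_def using \<tau> by (auto simp: field_simps)
  define \<delta> where "\<delta> = (\<sigma> - \<tau>) / 2"
  have \<delta>: "\<delta> > 0" "\<delta> < \<sigma>" "\<tau> * q - \<sigma> = - \<delta>" using \<tau> q unfolding \<delta>_def by (auto simp: field_simps)
  have "eventually (\<lambda>z. ptilde p z / p z < q) at_infinity"
    using order_tendstoD(2)[OF tilde_lim q(1)] .
  then obtain R0 where R0: "\<And>z. norm z \<ge> R0 \<Longrightarrow> ptilde p z / p z < q"
    unfolding eventually_at_infinity by blast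
  \<comment> \<open>The second entry forces \<open>p z > 0\<close> beyond radius \<open>R\<close>,
    so the bound on the quotient may be multiplied by \<open>p z\<close>.\<close>
  define R where "R = max R0 ((\<bar>C0\<bar> + 1) / k)"
  obtain m where m: "\<And>w. w \<in> cball 0 (R + 1) \<Longrightarrow> p w \<le> m" using plurisubharmonic_bounded_above[OF psh] by metis
  define C where "C = exp (2 * \<delta> * C0) + exp (2 * \<tau> * m + 2 * \<sigma> * C0)"
  show thesis
  proof (rule that[of "2 * \<delta> * k" C])
    show "2 * \<delta> * k > 0" using \<delta> k by simp
    show "C > 0" unfolding C_def by (simp add: add_pos_pos)
    fix z :: "complex^'n"
    show "exp (2 * \<tau> * ptilde p z - 2 * \<sigma> * p z) \<le> C * exp (- (2 * \<delta> * k) * norm z)"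
    proof (cases "norm z \<ge> R")
      case True
      then have "norm z \<ge> (\<bar>C0\<bar> + 1) / k" unfolding R_def by simp
      then have "k * norm z \<ge> \<bar>C0\<bar> + 1" using k by (simp add: field_simps)
      then have p0: "p z > 0" using pk[of z] by linarith
      have "ptilde p z / p z < q" using True R0 unfolding R_def by simp
      then have "ptilde p z \<le> q * p z" using p0 by (simp add: field_simps)
      then have "\<tau> * ptilde p z \<le> \<tau> * (q * p z)" using \<tau> by (intro mult_left_mono) auto
      moreover have "\<tau> * (q * p z) - \<sigma> * p z = - \<delta> * p z" using \<delta>(3) by (metis left_diff_distrib mult.assoc)
      moreover have "\<delta> * (k * norm z - C0) \<le> \<delta> * p z" using \<delta> pk by (intro mult_left_mono) auto
      ultimately have "2 * \<tau> * ptilde p z - 2 * \<sigma> * p z \<le> 2 * \<delta> * C0 + (- (2 * \<delta> * k) * norm z)"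
        by (simp add: algebra_simps)
      then have "exp (2 * \<tau> * ptilde p z - 2 * \<sigma> * p z) \<le> exp (2 * \<delta> * C0) * exp (- (2 * \<delta> * k) * norm z)"
        by (simp add: exp_add[symmetric])
      also have "\<dots> \<le> C * exp (- (2 * \<delta> * k) * norm z)"
        unfolding C_def by (intro mult_right_mono) auto
      finally show ?thesis .
    next
      case False
      have "ptilde p z \<le> m"
      proof (rule ptilde_le)
        fix w assume "w \<in> cball z 1"
        then show "p w \<le> m" using False norm_triangle_ineq2[of w z] by (intro m) (auto simp: dist_norm norm_minus_commute)
      qed
      then have "\<tau> * ptilde p z \<le> \<tau> * m" using \<tau> by (intro mult_left_mono) auto
      moreover have "\<sigma> * (k * norm z - C0) \<le> \<sigma> * p z" using \<tau> pk by (intro mult_left_mono) auto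
      \<comment> \<open>The available rate is weakened from \<sigma> to \<delta> so that both
        regions share the same exponential.\<close>
      moreover have "\<delta> * (k * norm z) \<le> \<sigma> * (k * norm z)" using \<delta> k by (intro mult_right_mono) auto
      ultimately have "2 * \<tau> * ptilde p z - 2 * \<sigma> * p z \<le> (2 * \<tau> * m + 2 * \<sigma> * C0) + (- (2 * \<delta> * k) * norm z)"
        by (simp add: algebra_simps)
      then have "exp (2 * \<tau> * ptilde p z - 2 * \<sigma> * p z) \<le> exp (2 * \<tau> * m + 2 * \<sigma> * C0) * exp (- (2 * \<delta> * k) * norm z)"
        by (simp add: exp_add[symmetric])
      also have "\<dots> \<le> C * exp (- (2 * \<delta> * k) * norm z)"
        unfolding C_def by (intro mult_right_mono) auto
      finally show ?thesis .
    qed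
  qed
qed

section \<open>Weak derivatives\<close>

lemma has_derivative_along_line:
  assumes "(F has_derivative D) (at (z + t *\<^sub>R v))"
  shows "((\<lambda>t. F (z + t *\<^sub>R v)) has_derivative (\<lambda>s. s *\<^sub>R D v)) (at t)"
proof -
  have "((\<lambda>t. z + t *\<^sub>R v) has_derivative (\<lambda>s. s *\<^sub>R v)) (at t)"
    by (auto intro!: derivative_eq_intros)
  from has_derivative_compose[OF this assms]
  have "((\<lambda>t. F (z + t *\<^sub>R v)) has_derivative (\<lambda>s. D (s *\<^sub>R v))) (at t)" .
  then show ?thesis
    using has_derivative_bounded_linear[OF assms] by (simp add: linear_simps)
qed

lemma difference_quotient_tendsto:
  assumes "(F has_derivative D) (at z)"
  shows "(\<lambda>n. real (Suc n) *\<^sub>R (F (z + (1 / real (Suc n)) *\<^sub>R v) - F z)) \<longlonglongrightarrow> D v"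
proof -
  let ?f = "\<lambda>t::real. F (z + t *\<^sub>R v)"
  have "(?f has_derivative (\<lambda>s. s *\<^sub>R D v)) (at 0)"
    using has_derivative_along_line[of F D z 0 v] assms by simp
  then have lim: "((\<lambda>h. norm (?f (0 + h) - ?f 0 - h *\<^sub>R D v) / norm h) \<longlongrightarrow> 0) (at 0)"
    unfolding has_derivative_at by blast
  have "filterlim (\<lambda>n. 1 / real (Suc n)) (at 0) sequentially"
    using LIMSEQ_inverse_real_of_nat by (intro filterlim_atI) (auto simp: inverse_eq_divide)
  from filterlim_compose[OF lim this]
  have "(\<lambda>n. norm (?f (1 / real (Suc n)) - ?f 0 - (1 / real (Suc n)) *\<^sub>R D v) / norm (1 / real (Suc n))) \<longlonglongrightarrow> 0"
    by simp
  moreover have "norm (?f (1 / real (Suc n)) - ?f 0 - (1 / real (Suc n)) *\<^sub>R D v) / norm (1 / real (Suc n))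
      = norm (real (Suc n) *\<^sub>R (F (z + (1 / real (Suc n)) *\<^sub>R v) - F z) - D v)" for n
  proof -
    have "norm (real (Suc n) *\<^sub>R (F (z + (1 / real (Suc n)) *\<^sub>R v) - F z) - D v)
      = norm (real (Suc n) *\<^sub>R (?f (1 / real (Suc n)) - ?f 0 - (1 / real (Suc n)) *\<^sub>R D v))"
      by (rule arg_cong[where f=norm]) (simp add: scaleR_diff_right del: of_nat_Suc)
    then show ?thesis by (simp add: del: of_nat_Suc)
  qed
  ultimately have "(\<lambda>n. norm (real (Suc n) *\<^sub>R (F (z + (1 / real (Suc n)) *\<^sub>R v) - F z) - D v)) \<longlonglongrightarrow> 0"
    by simp
  then show ?thesis
    by (simp only: tendsto_norm_zero_iff LIM_zero_iff)
qed

lemma integrable_continuous_compact_support: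
  fixes F :: "'a::euclidean_space \<Rightarrow> 'b::euclidean_space"
  assumes c: "continuous_on UNIV F" and s: "\<And>z. z \<notin> cball 0 R \<Longrightarrow> F z = 0"
  shows "integrable lborel F"
proof -
  have "integrable lborel (\<lambda>x. indicator (cball 0 R) x *\<^sub>R F x)"
    by (intro borel_integrable_compact continuous_on_subset[OF c]) auto
  moreover have "(\<lambda>x. indicator (cball 0 R) x *\<^sub>R F x) = F" using s by (auto simp: fun_eq_iff indicator_def)
  ultimately show ?thesis by simp
qed

text \<open>The integrals of the difference quotients vanish by translation invariance; the bound on the
  derivative dominates them.\<close>

lemma integral_directional_derivative_zero:
  fixes F :: "'a::euclidean_space \<Rightarrow> 'b::euclidean_space"
  assumes der: "\<And>z. (F has_derivative D z) (at z)"
    and supp: "\<And>z. z \<notin> cball 0 R \<Longrightarrow> F z = 0"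
    and bound: "\<And>z. z \<in> cball 0 R \<Longrightarrow> norm (D z v) \<le> B"
  shows "integrable lborel (\<lambda>z. D z v)" "(\<integral>z. D z v \<partial>lborel) = 0"
proof -
  have cont: "continuous_on UNIV F"
    by (meson continuous_at_imp_continuous_on der has_derivative_continuous)
  have [measurable]: "F \<in> borel_measurable borel" by (rule borel_measurable_continuous_onI[OF cont])
  have D0: "D z v = 0" if "z \<notin> cball 0 R" for z
  proof -
    have "((\<lambda>_. 0) has_derivative (\<lambda>_. 0::'b)) (at z)" by simp
    then have "(F has_derivative (\<lambda>_. 0)) (at z)"
      by (rule has_derivative_transform_within_open[of _ _ _ _ "- cball 0 R"]) (use that supp in auto)
    then show ?thesis using has_derivative_unique[OF der] by metis
  qed
  \<comment> \<open>The absolute value covers an empty ball, where \<open>B\<close> may be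
    negative.\<close>
  have B': "norm (D z v) \<le> \<bar>B\<bar>" for z
    using D0[of z] bound[of z] by (cases "z \<in> cball 0 R") auto
  define g where "g n z = real (Suc n) *\<^sub>R (F (z + (1 / real (Suc n)) *\<^sub>R v) - F z)" for n z
  have [measurable]: "g n \<in> borel_measurable borel" for n unfolding g_def by measurable
  have lim: "(\<lambda>n. g n z) \<longlonglongrightarrow> D z v" for z
    unfolding g_def by (rule difference_quotient_tendsto[OF der])
  have gb: "norm (g n z) \<le> \<bar>B\<bar>" for n z
  proof -
    let ?h = "1 / real (Suc n)"
    have "norm (F (z + ?h *\<^sub>R v) - F (z + 0 *\<^sub>R v)) \<le> \<bar>B\<bar> * norm (?h - 0)"
    proof (rule differentiable_bound[of UNIV "\<lambda>t. F (z + t *\<^sub>R v)" "\<lambda>t s. s *\<^sub>R D (z + t *\<^sub>R v) v"])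
      fix t :: real
      show "((\<lambda>t. F (z + t *\<^sub>R v)) has_derivative (\<lambda>s. s *\<^sub>R D (z + t *\<^sub>R v) v)) (at t within UNIV)"
        using has_derivative_along_line[OF der] by simp
      show "onorm (\<lambda>s. s *\<^sub>R D (z + t *\<^sub>R v) v) \<le> \<bar>B\<bar>"
        by (rule onorm_le) (simp add: mult.commute mult_left_mono B')
    qed auto
    then have "real (Suc n) * norm (F (z + ?h *\<^sub>R v) - F z) \<le> real (Suc n) * (\<bar>B\<bar> * norm ?h)"
      by (intro mult_left_mono) auto
    then show ?thesis unfolding g_def by (simp add: del: of_nat_Suc)
  qed
  \<comment> \<open>All steps have length at most \<open>norm v\<close>, so the difference quotients
    vanish outside one common ball; its indicator times the bound is the dominating
    function.\<close>
  have g0: "g n z = 0" if "z \<notin> cball 0 (R + norm v)" for n z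
  proof -
    have "norm ((1 / real (Suc n)) *\<^sub>R v) \<le> norm v"
      using mult_right_mono[of "1 / real (Suc n)" 1 "norm v"] by simp
    then have "z + (1 / real (Suc n)) *\<^sub>R v \<notin> cball 0 R" "z \<notin> cball 0 R"
      using that norm_ge_zero[of v] norm_diff_ineq[of z "(1 / real (Suc n)) *\<^sub>R v"] by (auto simp del: norm_scaleR norm_ge_zero)
    then show ?thesis unfolding g_def by (simp add: supp)
  qed
  define w where "w z = \<bar>B\<bar> * indicator (cball 0 (R + norm v)) z" for z :: 'a
  have wint: "integrable lborel w"
    unfolding w_def by (intro integrable_mult_right integrable_real_indicator)
      (use emeasure_lborel_cball_finite[of "0::'a" "R + norm v"] in \<open>auto intro!: borel_closed\<close>)
  have gw: "norm (g n z) \<le> w z" for n z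
    unfolding w_def using gb[of n z] g0[of z n] by (auto simp: indicator_def)
  have Dm: "(\<lambda>z. D z v) \<in> borel_measurable lborel"
    by (rule borel_measurable_LIMSEQ_metric[of g]) (use lim in auto)
  show "integrable lborel (\<lambda>z. D z v)"
    by (rule integrable_dominated_convergence[where s=g and w=w]) (use Dm wint lim gw in auto)
  have conv: "(\<lambda>n. (\<integral>z. g n z \<partial>lborel)) \<longlonglongrightarrow> (\<integral>z. D z v \<partial>lborel)"
    by (rule integral_dominated_convergence[where w=w]) (use Dm wint lim gw in auto)
  have Fi: "integrable lborel F" by (rule integrable_continuous_compact_support[OF cont supp])
  have "(\<integral>z. g n z \<partial>lborel) = 0" for n
  proof -
    let ?c = "(1 / real (Suc n)) *\<^sub>R v"
    have eq: "lborel = distr lborel borel ((+) ?c)" by (simp add: lborel_distr_plus)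
    have "integrable (distr lborel borel ((+) ?c)) F" using Fi by (subst eq[symmetric])
    then have i: "integrable lborel (\<lambda>z. F (z + ?c))"
      by (subst (asm) integrable_distr_eq) (auto simp: add.commute)
    have "(\<integral>z. F z \<partial>lborel) = (\<integral>z. F z \<partial>distr lborel borel ((+) ?c))" by (subst eq[symmetric]) simp
    also have "\<dots> = (\<integral>z. F (z + ?c) \<partial>lborel)" by (subst integral_distr) (auto simp: add.commute)
    finally show ?thesis unfolding g_def using i Fi by simp
  qed
  with conv show "(\<integral>z. D z v \<partial>lborel) = 0" by (simp add: LIMSEQ_const_iff)
qed

text \<open>Integration by parts: \<open>u * \<phi>\<close> has compact support, so its directional
  derivatives integrate to zero, and the product rule splits the combination for d-bar into the two
  integrals to be compared. Local boundedness of \<open>D\<close> provides the domination.\<close>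

lemma weak_dbar_classical:
  fixes u :: "complex^'n \<Rightarrow> complex"
  assumes der: "\<And>z. (u has_derivative D z) (at z)"
    and bd: "\<And>R v. \<exists>B. \<forall>z\<in>cball 0 R. cmod (D z v) \<le> B"
    and cf: "\<And>j. continuous_on UNIV (f j)"
    and eq: "\<And>j z. f j z = (D z (axis j 1) + \<i> * D z (axis j \<i>)) / 2"
  shows "weak_dbar u f"
  unfolding weak_dbar_def
proof (intro allI impI)
  fix j and \<phi> :: "complex^'n \<Rightarrow> complex"
  assume t: "test_fun \<phi>"
  define P where "P z = frechet_derivative \<phi> (at z)" for z
  \<comment> \<open>The class \<open>S\<close> is closed under directional derivatives, so each
    \<open>P z v\<close> is again differentiable in \<open>z\<close>, hence continuous.\<close>
  obtain S where S: "\<phi> \<in> S" "\<And>g z. g \<in> S \<Longrightarrow> g differentiable (at z)"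
     "\<And>g v. g \<in> S \<Longrightarrow> (\<lambda>z. frechet_derivative g (at z) v) \<in> S"
    using t unfolding test_fun_def smooth_fun_def by blast
  have P: "(\<phi> has_derivative P z) (at z)" for z
    unfolding P_def using S(1,2) frechet_derivative_works by blast
  have dc: "continuous_on UNIV g" if "g \<in> S" for g
    using S(2)[OF that] by (simp add: continuous_at_imp_continuous_on differentiable_imp_continuous_within)
  have c\<phi>: "continuous_on UNIV \<phi>" using dc S by blast
  have cP: "continuous_on UNIV (\<lambda>z. P z v)" for v unfolding P_def using dc S by blast
  have cu: "continuous_on UNIV u" by (meson continuous_at_imp_continuous_on der has_derivative_continuous)
  have "bounded (closure {z. \<phi> z \<noteq> 0})" using t unfolding test_fun_def by (simp add: compact_imp_bounded)
  then obtain R where "\<forall>z\<in>closure {z. \<phi> z \<noteq> 0}. norm z \<le> R" unfolding bounded_iff by blast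
  then have R: "\<phi> z = 0" if "z \<notin> cball 0 R" for z using that closure_subset[of "{z. \<phi> z \<noteq> 0}"] by auto
  have P0: "P z v = 0" if "z \<notin> cball 0 R" for z v
  proof -
    have "((\<lambda>_. 0) has_derivative (\<lambda>_. 0::complex)) (at z)" by simp
    then have "(\<phi> has_derivative (\<lambda>_. 0)) (at z)"
      by (rule has_derivative_transform_within_open[of _ _ _ _ "- cball 0 R"]) (use that R in auto)
    then show ?thesis using has_derivative_unique[OF P] by metis
  qed
  define F where "F z = u z * \<phi> z" for z
  define G where "G z v = u z * P z v + D z v * \<phi> z" for z v
  have G: "(F has_derivative G z) (at z)" for z
    unfolding F_def G_def by (rule has_derivative_mult[OF der P])
  have cb: "\<exists>B. \<forall>z\<in>cball 0 R. cmod (h z) \<le> B" if "continuous_on UNIV h" for h :: "complex^'n \<Rightarrow> complex"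
    using compact_imp_bounded[OF compact_continuous_image[OF continuous_on_subset[OF that] compact_cball[of 0 R]]]
    unfolding bounded_iff by auto
  have Gint: "integrable lborel (\<lambda>z. G z v)" "(\<integral>z. G z v \<partial>lborel) = 0" for v
  proof -
    obtain B1 where B1: "\<forall>z\<in>cball 0 R. cmod (u z * P z v) \<le> B1" using cb[of "\<lambda>z. u z * P z v"] cu cP continuous_on_mult by blast
    obtain B2 where B2: "\<forall>z\<in>cball 0 R. cmod (D z v) \<le> B2" using bd by blast
    obtain B3 where B3: "\<forall>z\<in>cball 0 R. cmod (\<phi> z) \<le> B3" using cb[OF c\<phi>] by blast
    have "cmod (G z v) \<le> B1 + B2 * B3" if z: "z \<in> cball 0 R" for z
    proof -
      have "cmod (G z v) \<le> cmod (u z * P z v) + cmod (D z v) * cmod (\<phi> z)"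
        unfolding G_def by (metis norm_mult norm_triangle_ineq)
      also have "\<dots> \<le> B1 + B2 * B3"
      proof -
        have "0 \<le> B2" using B2 z norm_ge_zero order_trans by blast
        then show ?thesis using B1 B2 B3 z by (intro add_mono mult_mono) auto
      qed
      finally show ?thesis .
    qed
    moreover have "F z = 0" if "z \<notin> cball 0 R" for z unfolding F_def using R that by simp
    ultimately show "integrable lborel (\<lambda>z. G z v)" "(\<integral>z. G z v \<partial>lborel) = 0"
      using integral_directional_derivative_zero[of F G R v "B1 + B2 * B3"] G by blast+
  qed
  have db: "dbar_j j \<phi> z = (P z (axis j 1) + \<i> * P z (axis j \<i>)) / 2" for z
    unfolding dbar_j_def P_def ..
  have c1: "continuous_on UNIV (\<lambda>z. u z * dbar_j j \<phi> z)"
    unfolding db by (intro continuous_intros cu cP) auto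
  have c2: "continuous_on UNIV (\<lambda>z. f j z * \<phi> z)"
    by (intro continuous_intros cf c\<phi>)
  have i1: "integrable lborel (\<lambda>z. u z * dbar_j j \<phi> z)"
    by (rule integrable_continuous_compact_support[OF c1, of R]) (simp add: db P0)
  have i2: "integrable lborel (\<lambda>z. f j z * \<phi> z)"
    by (rule integrable_continuous_compact_support[OF c2, of R]) (use R in simp)
  have "(\<integral>z. u z * dbar_j j \<phi> z \<partial>lborel) + (\<integral>z. f j z * \<phi> z \<partial>lborel)
     = (\<integral>z. u z * dbar_j j \<phi> z + f j z * \<phi> z \<partial>lborel)"
    using i1 i2 by simp
  \<comment> \<open>The real directions \<open>axis j 1\<close> and \<open>axis j \<i>\<close>,
    weighted by \<open>1/2\<close> and \<open>\<i>/2\<close>, assemble the d-bar derivative of the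
    product.\<close>
  also have "\<dots> = (\<integral>z. (1/2) * G z (axis j 1) + (\<i>/2) * G z (axis j \<i>) \<partial>lborel)"
    by (rule Bochner_Integration.integral_cong) (auto simp: db eq G_def field_simps)
  also have "\<dots> = 0" using Gint by simp
  finally have "(\<integral>z. u z * dbar_j j \<phi> z \<partial>lborel) + (\<integral>z. f j z * \<phi> z \<partial>lborel) = 0" .
  moreover have "(\<integral>z. u z * dbar_j j \<phi> z \<partial>lebesgue) = (\<integral>z. u z * dbar_j j \<phi> z \<partial>lborel)"
    by (rule integral_completion) (use borel_measurable_continuous_onI[OF c1] in simp)
  moreover have "(\<integral>z. f j z * \<phi> z \<partial>lebesgue) = (\<integral>z. f j z * \<phi> z \<partial>lborel)"
    by (rule integral_completion) (use borel_measurable_continuous_onI[OF c2] in simp)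
  ultimately show "(\<integral>z. u z * dbar_j j \<phi> z \<partial>lebesgue) = - (\<integral>z. f j z * \<phi> z \<partial>lebesgue)"
    by (simp add: eq_neg_iff_add_eq_0)
qed

section \<open>The explicit solution of the d-bar equation\<close>

lemma entire_derivative_locally_bounded:
  assumes g: "entire g"
  shows "\<exists>B. \<forall>z\<in>cball 0 R. cmod (frechet_derivative g (at z) v) \<le> B"
proof -
  have "bounded (g ` cball 0 (R + 1))"
    by (intro compact_imp_bounded compact_continuous_image entire_continuous_on g compact_cball)
  then obtain B where B: "\<forall>w\<in>cball 0 (R + 1). cmod (g w) \<le> B" unfolding bounded_iff by auto
  have "cmod (frechet_derivative g (at z) v) \<le> B * norm v" if z: "z \<in> cball 0 R" for z
  proof (rule entire_derivative_bound[OF g])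
    fix w assume "w \<in> cball z 1"
    then have "w \<in> cball 0 (R + 1)" using z norm_triangle_ineq2[of w z] by (auto simp: dist_norm norm_minus_commute)
    then show "cmod (g w) \<le> B" using B by blast
  qed
  then show ?thesis by blast
qed

text \<open>The Cauchy-Riemann equations: complex homogeneity in the direction
  \<open>\<i> *s axis j 1\<close> yields a second factor \<open>\<i>\<close>, and the terms
  cancel.\<close>

lemma entire_derivative_dbar_zero:
  assumes g: "entire g"
  shows "frechet_derivative g (at z) (axis j 1) + \<i> * frechet_derivative g (at z) (axis j \<i>) = 0"
proof -
  have "axis j \<i> = \<i> *s axis j 1" by (simp add: vec_eq_iff axis_def)
  then have "frechet_derivative g (at z) (axis j \<i>) = \<i> * frechet_derivative g (at z) (axis j 1)"
    using entire_has_derivative(2)[OF g] by metis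
  then show ?thesis by simp
qed

text \<open>Only the conjugated coordinates are seen by d-bar, since \<open>f k\<close> and
  \<open>h\<close> are entire. The term \<open>h\<close> is included so that the remainder of an
  orthogonal projection is covered.\<close>

lemma weak_dbar_conj_pairing:
  fixes f :: "'n \<Rightarrow> complex^'n \<Rightarrow> complex"
  assumes f: "\<And>k. entire (f k)" and h: "entire h"
  shows "weak_dbar (\<lambda>z. (\<Sum>k\<in>UNIV. f k z * cnj (z $ k)) - h z) f"
proof (rule weak_dbar_classical)
  let ?F = "\<lambda>k z. frechet_derivative (f k) (at z)"
  let ?H = "\<lambda>z. frechet_derivative h (at z)"
  let ?D = "\<lambda>z v. (\<Sum>k\<in>UNIV. f k z * cnj (v $ k) + ?F k z v * cnj (z $ k)) - ?H z v"
  show "continuous_on UNIV (f j)" for j by (rule entire_continuous_on[OF f])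
  have bl: "bounded_linear (\<lambda>z::complex^'n. cnj (z $ k))" for k
    using bounded_linear_compose[OF bounded_linear_cnj bounded_linear_vec_nth] .
  show "((\<lambda>z. (\<Sum>k\<in>UNIV. f k z * cnj (z $ k)) - h z) has_derivative ?D z) (at z)" for z
    by (intro has_derivative_diff has_derivative_sum has_derivative_mult entire_has_derivative f h
        bounded_linear_imp_has_derivative bl)
  show "f j z = (?D z (axis j 1) + \<i> * ?D z (axis j \<i>)) / 2" for j z
  proof -
    have "?D z (axis j 1) + \<i> * ?D z (axis j \<i>)
       = (\<Sum>k\<in>UNIV. f k z * (cnj (axis j 1 $ k) + \<i> * cnj (axis j \<i> $ k)))
         + (\<Sum>k\<in>UNIV. (?F k z (axis j 1) + \<i> * ?F k z (axis j \<i>)) * cnj (z $ k))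
         - (?H z (axis j 1) + \<i> * ?H z (axis j \<i>))"
      by (simp add: sum.distrib sum_distrib_left algebra_simps)
    also have "\<dots> = (\<Sum>k\<in>UNIV. f k z * (cnj (axis j 1 $ k) + \<i> * cnj (axis j \<i> $ k)))"
      by (simp add: entire_derivative_dbar_zero f h)
    \<comment> \<open>At \<open>k = j\<close> the bracket is \<open>1 + \<i> * cnj \<i> = 2\<close>,
      which the division by 2 in d-bar removes.\<close>
    also have "\<dots> = (\<Sum>k\<in>UNIV. if k = j then 2 * f k z else 0)"
      by (rule sum.cong) (auto simp: axis_def)
    finally show ?thesis by simp
  qed
  show "\<exists>B. \<forall>z\<in>cball 0 R. cmod (?D z v) \<le> B" for R v
  proof -
    have "\<exists>B. \<forall>z\<in>cball 0 R. cmod (f k z) \<le> B" for k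
    proof -
      have "bounded (f k ` cball 0 R)"
        by (intro compact_imp_bounded compact_continuous_image entire_continuous_on f compact_cball)
      then show ?thesis unfolding bounded_iff by auto
    qed
    then obtain A where A: "\<And>k z. z \<in> cball 0 R \<Longrightarrow> cmod (f k z) \<le> A k" by metis
    have "\<forall>k. \<exists>B. \<forall>z\<in>cball 0 R. cmod (?F k z v) \<le> B"
      using entire_derivative_locally_bounded[OF f] by blast
    then obtain B where B: "\<And>k z. z \<in> cball 0 R \<Longrightarrow> cmod (?F k z v) \<le> B k" by metis
    obtain E where E: "\<And>z. z \<in> cball 0 R \<Longrightarrow> cmod (?H z v) \<le> E"
      using entire_derivative_locally_bounded[OF h] by blast
    have "cmod (?D z v) \<le> (\<Sum>k\<in>UNIV. A k * norm v + B k * R) + E" if z: "z \<in> cball 0 R" for z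
    proof -
      have "cmod (?D z v) \<le> cmod (\<Sum>k\<in>UNIV. f k z * cnj (v $ k) + ?F k z v * cnj (z $ k)) + cmod (?H z v)"
        by (rule norm_triangle_ineq4)
      also have "\<dots> \<le> (\<Sum>k\<in>UNIV. A k * norm v + B k * R) + E"
      proof (rule add_mono[OF sum_norm_le E[OF z]])
        fix k
        have "cmod (f k z * cnj (v $ k) + ?F k z v * cnj (z $ k)) \<le> cmod (f k z) * cmod (v $ k) + cmod (?F k z v) * cmod (z $ k)"
          by (metis norm_triangle_ineq norm_mult complex_mod_cnj)
        also have "\<dots> \<le> A k * norm v + B k * R"
        proof (intro add_mono mult_mono)
          show "cmod (z $ k) \<le> R" using z Finite_Cartesian_Product.norm_nth_le[of z k] by (auto intro: order_trans)
          show "0 \<le> A k" "0 \<le> B k" using A[OF z, of k] B[OF z, of k] norm_ge_zero order_trans by blast+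
        qed (use A[OF z] B[OF z] Finite_Cartesian_Product.norm_nth_le[of v k] in auto)
        finally show "cmod (f k z * cnj (v $ k) + ?F k z v * cnj (z $ k)) \<le> A k * norm v + B k * R" .
      qed
      finally show ?thesis .
    qed
    then show ?thesis by blast
  qed
qed

section \<open>Weighted Bergman spaces and the canonical solution\<close>

text \<open>Moving the weight into the measure makes the general square integrable theory
  applicable. The base is \<open>lebesgue\<close>, not \<open>lborel\<close>, to match the
  measurability demanded by \<open>L2w\<close>.\<close>

definition weighted_measure :: "(complex^'n \<Rightarrow> real) \<Rightarrow> real \<Rightarrow> (complex^'n) measure" where
  "weighted_measure p s = density lebesgue (\<lambda>z. ennreal (exp (-2 * s * p z)))"

lemma borel_measurable_weighted_measure:
  "borel_measurable (weighted_measure p s) = borel_measurable lebesgue"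
  by (auto simp: weighted_measure_def)

lemma borel_imp_lebesgue_measurable: "f \<in> borel_measurable borel \<Longrightarrow> f \<in> borel_measurable lebesgue"
  by (rule measurable_completion) simp

lemma weight_measurable:
  fixes p :: "complex^'n \<Rightarrow> real"
  shows "p \<in> borel_measurable borel \<Longrightarrow> (\<lambda>z. exp (-2 * s * p z)) \<in> borel_measurable lebesgue"
  by (rule borel_imp_lebesgue_measurable) measurable

lemma wnorm2_eq_nn_integral:
  assumes p: "p \<in> borel_measurable borel" and u[measurable]: "u \<in> borel_measurable lebesgue"
  shows "wnorm2 p s u = (\<integral>\<^sup>+z. ennreal ((cmod (u z))\<^sup>2) \<partial>weighted_measure p s)"
  unfolding wnorm2_def weighted_measure_def using weight_measurable[OF p, of s]
  by (subst nn_integral_density) (auto simp: ennreal_mult mult.commute)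

lemma L2w_iff_sq_integrable:
  assumes p: "p \<in> borel_measurable borel"
  shows "u \<in> L2w p s \<longleftrightarrow> sq_integrable (weighted_measure p s) u"
proof -
  have "integrable (weighted_measure p s) (\<lambda>z. (cmod (u z))\<^sup>2)
      \<longleftrightarrow> (\<integral>\<^sup>+z. ennreal ((cmod (u z))\<^sup>2) \<partial>weighted_measure p s) < \<infinity>"
    if [measurable]: "u \<in> borel_measurable lebesgue"
  proof -
    have "(\<lambda>z. (cmod (u z))\<^sup>2) \<in> borel_measurable (weighted_measure p s)"
      unfolding borel_measurable_weighted_measure by measurable
    then show ?thesis by (simp add: integrable_iff_bounded)
  qed
  then show ?thesis
    unfolding L2w_def sq_integrable_def borel_measurable_weighted_measure
    using wnorm2_eq_nn_integral[OF p] by auto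
qed

lemma wnorm2_eq_l2_norm2:
  assumes p: "p \<in> borel_measurable borel" and u: "u \<in> L2w p s"
  shows "wnorm2 p s u = ennreal (l2_norm2 (weighted_measure p s) u)"
  using nn_integral_eq_l2_norm2[OF u[unfolded L2w_iff_sq_integrable[OF p]]] u
  by (simp add: wnorm2_eq_nn_integral[OF p] L2w_def)

lemma winner_eq_l2_inner:
  assumes p: "p \<in> borel_measurable borel"
    and [measurable]: "u \<in> borel_measurable lebesgue" "v \<in> borel_measurable lebesgue"
  shows "winner p s u v = l2_inner (weighted_measure p s) u v"
proof -
  have [measurable]: "cnj \<in> borel_measurable borel"
    by (intro borel_measurable_continuous_onI continuous_intros)
  have "l2_inner (weighted_measure p s) u v = (\<integral>z. exp (-2 * s * p z) *\<^sub>R (u z * cnj (v z)) \<partial>lebesgue)"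
    unfolding l2_inner_def weighted_measure_def
  proof (rule integral_density)
    show "(\<lambda>z. u z * cnj (v z)) \<in> borel_measurable lebesgue" by measurable
  qed (use weight_measurable[OF p] in auto)
  then show ?thesis
    unfolding winner_def scaleR_conv_of_real by (simp only: mult.commute)
qed

lemma A2w_iff:
  assumes p: "p \<in> borel_measurable borel"
  shows "u \<in> A2w p s \<longleftrightarrow> sq_integrable (weighted_measure p s) u \<and> entire u"
  by (simp add: A2w_def L2w_iff_sq_integrable[OF p])

lemma A2w_add: "p \<in> borel_measurable borel \<Longrightarrow> u \<in> A2w p s \<Longrightarrow> v \<in> A2w p s \<Longrightarrow> (\<lambda>z. u z + v z) \<in> A2w p s"
  and A2w_diff: "p \<in> borel_measurable borel \<Longrightarrow> u \<in> A2w p s \<Longrightarrow> v \<in> A2w p s \<Longrightarrow> (\<lambda>z. u z - v z) \<in> A2w p s"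
  and A2w_cmult: "p \<in> borel_measurable borel \<Longrightarrow> u \<in> A2w p s \<Longrightarrow> (\<lambda>z. c * u z) \<in> A2w p s"
  and A2w_zero: "p \<in> borel_measurable borel \<Longrightarrow> (\<lambda>z. 0) \<in> A2w p s"
  by (simp_all add: A2w_iff sq_integrable_add sq_integrable_diff sq_integrable_cmult sq_integrable_zero
      entire_add entire_diff entire_cmult entire_const)

lemma A2w_sum:
  assumes "p \<in> borel_measurable borel" "finite A" "\<And>i. i \<in> A \<Longrightarrow> u i \<in> A2w p s"
  shows "(\<lambda>z. \<Sum>i\<in>A. u i z) \<in> A2w p s"
  using assms by (simp add: A2w_iff sq_integrable_sum entire_sum)

lemma A2w_lebesgue_measurable: "u \<in> A2w p s \<Longrightarrow> u \<in> borel_measurable lebesgue"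
  by (simp add: A2w_def L2w_def)

text \<open>On \<open>cball z 1\<close> the weight is at least
  \<open>exp (- 2 * s * ptilde p z)\<close>, so inserting it into the sub-mean value inequality
  costs just this factor; the integral is then enlarged to the whole space.\<close>

lemma A2w_point_evaluation:
  fixes p :: "complex^'n \<Rightarrow> real"
  assumes psh: "plurisubharmonic p" and s: "s > 0" and f: "f \<in> A2w p s"
  shows "(cmod (f z))\<^sup>2 \<le> exp (2 * s * ptilde p z) / unit_ball_vol (DIM(complex^'n))
     * l2_norm2 (weighted_measure p s) f"
proof -
  let ?V = "unit_ball_vol (DIM(complex^'n))"
  have p: "p \<in> borel_measurable borel" by (rule plurisubharmonic_borel_measurable[OF psh])
  note [measurable] = p
  have ent: "entire f" using f by (simp add: A2w_def)
  note [measurable] = entire_borel_measurable[OF ent]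
  have "ennreal (?V * (cmod (f z))\<^sup>2) = emeasure lborel (cball (0::complex^'n) 1) * ennreal ((cmod (f z))\<^sup>2)"
    by (subst emeasure_cball) (auto simp: ennreal_mult)
  also have "\<dots> \<le> (\<integral>\<^sup>+w. indicator (cball z 1) w * ennreal ((cmod (f w))\<^sup>2) \<partial>lborel)"
    by (rule entire_submean[OF ent])
  also have "\<dots> \<le> (\<integral>\<^sup>+w. ennreal (exp (2 * s * ptilde p z)) * ennreal ((cmod (f w))\<^sup>2 * exp (-2 * s * p w)) \<partial>lborel)"
  proof (rule nn_integral_mono)
    fix w :: "complex^'n"
    show "indicator (cball z 1) w * ennreal ((cmod (f w))\<^sup>2) \<le> ennreal (exp (2 * s * ptilde p z)) * ennreal ((cmod (f w))\<^sup>2 * exp (-2 * s * p w))"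
    proof (cases "w \<in> cball z 1")
      case True
      have "2 * s * p w \<le> 2 * s * ptilde p z" using le_ptilde[OF psh True] s by simp
      then have "1 \<le> exp (2 * s * ptilde p z) * exp (-2 * s * p w)" by (simp add: exp_add[symmetric])
      then have "(cmod (f w))\<^sup>2 * 1 \<le> (cmod (f w))\<^sup>2 * (exp (2 * s * ptilde p z) * exp (-2 * s * p w))"
        by (rule mult_left_mono) simp
      then have "(cmod (f w))\<^sup>2 \<le> exp (2 * s * ptilde p z) * ((cmod (f w))\<^sup>2 * exp (-2 * s * p w))"
        by (simp only: mult_ac mult_1_right mult_1_left)
      then show ?thesis using True by (simp add: ennreal_mult[symmetric] ennreal_leI)
    qed simp
  qed
  also have "\<dots> = ennreal (exp (2 * s * ptilde p z)) * wnorm2 p s f"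
    unfolding wnorm2_def nn_integral_completion by (rule nn_integral_cmult) measurable
  also have "\<dots> = ennreal (exp (2 * s * ptilde p z) * l2_norm2 (weighted_measure p s) f)"
    using f by (subst wnorm2_eq_l2_norm2[OF p]) (auto simp: A2w_def ennreal_mult l2_norm2_nonneg)
  finally have "?V * (cmod (f z))\<^sup>2 \<le> exp (2 * s * ptilde p z) * l2_norm2 (weighted_measure p s) f"
    by (subst (asm) ennreal_le_iff) (auto simp: l2_norm2_nonneg)
  moreover have "?V > 0" by simp
  ultimately show ?thesis by (simp add: field_simps)
qed

text \<open>The closedness condition of the projection lemma. Evaluations at the points of a ball
  have a common bound, which turns norm-Cauchy into uniformly Cauchy there.\<close>

lemma A2w_cauchy_limit:
  fixes p :: "complex^'n \<Rightarrow> real"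
  assumes psh: "plurisubharmonic p" and s: "s > 0" and X: "\<And>n. X n \<in> A2w p s"
    and cau: "\<And>e. e > 0 \<Longrightarrow> \<exists>N. \<forall>m\<ge>N. \<forall>n\<ge>N. l2_norm2 (weighted_measure p s) (\<lambda>x. X m x - X n x) < e"
  shows "\<exists>h. (\<forall>x. (\<lambda>n. X n x) \<longlonglongrightarrow> h x) \<and> (sq_integrable (weighted_measure p s) h \<longrightarrow> h \<in> A2w p s)"
proof -
  let ?V = "unit_ball_vol (DIM(complex^'n))"
  have p: "p \<in> borel_measurable borel" by (rule plurisubharmonic_borel_measurable[OF psh])
  have unif: "\<exists>N. \<forall>m\<ge>N. \<forall>n\<ge>N. \<forall>z\<in>cball 0 R. cmod (X m z - X n z) \<le> e" if e: "e > 0" for R e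
  proof -
    obtain B where B: "\<And>w. w \<in> cball 0 (R + 1) \<Longrightarrow> p w \<le> B" using plurisubharmonic_bounded_above[OF psh] by metis
    \<comment> \<open>A common bound for the squared norms of evaluation at all points of
      \<open>cball 0 R\<close>; hence the tolerance \<open>e^2 / K\<close> in squared norm.\<close>
    define K where "K = exp (2 * s * B) / ?V"
    have K: "K > 0" by (simp add: K_def)
    then have "e\<^sup>2 / K > 0" using e by simp
    then obtain N where N: "\<forall>m\<ge>N. \<forall>n\<ge>N. l2_norm2 (weighted_measure p s) (\<lambda>x. X m x - X n x) < e\<^sup>2 / K"
      using cau by blast
    have "cmod (X m z - X n z) \<le> e" if mn: "m \<ge> N" "n \<ge> N" and z: "z \<in> cball 0 R" for m n z
    proof -
      have "ptilde p z \<le> B"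
      proof (rule ptilde_le)
        fix w assume "w \<in> cball z 1"
        then show "p w \<le> B" using z norm_triangle_ineq2[of w z] by (intro B) (auto simp: dist_norm norm_minus_commute)
      qed
      then have E: "exp (2 * s * ptilde p z) / ?V \<le> K" using s unfolding K_def by (intro divide_right_mono) auto
      have "(cmod (X m z - X n z))\<^sup>2 \<le> exp (2 * s * ptilde p z) / ?V * l2_norm2 (weighted_measure p s) (\<lambda>x. X m x - X n x)"
        by (rule A2w_point_evaluation[OF psh s A2w_diff[OF p X X]])
      also have "\<dots> \<le> K * (e\<^sup>2 / K)"
      proof (rule mult_mono[OF E])
        show "l2_norm2 (weighted_measure p s) (\<lambda>x. X m x - X n x) \<le> e\<^sup>2 / K"
          using N mn less_imp_le by blast
      qed (use K l2_norm2_nonneg in auto)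
      also have "\<dots> = e\<^sup>2" using K by simp
      finally show ?thesis by (rule power2_le_imp_le) (use e in simp)
    qed
    then show ?thesis by blast
  qed
  have "entire (X n)" for n using X A2w_iff[OF p] by blast
  then obtain h where "\<And>z. (\<lambda>n. X n z) \<longlonglongrightarrow> h z" "entire h"
    using entire_limit_exists[OF _ unif] by blast
  then show ?thesis using A2w_iff[OF p] by blast
qed

section \<open>Norm of the explicit solution and its projection\<close>

definition conj_pairing :: "('n \<Rightarrow> complex^'n \<Rightarrow> complex) \<Rightarrow> complex^'n \<Rightarrow> complex" where
  "conj_pairing f z = (\<Sum>k\<in>UNIV. f k z * cnj (z $ k))"

lemma conj_pairing_norm_le: "(cmod (conj_pairing f z))\<^sup>2 \<le> (norm z)\<^sup>2 * (\<Sum>k\<in>UNIV. (cmod (f k z))\<^sup>2)"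
proof -
  have "cmod (conj_pairing f z) \<le> (\<Sum>k\<in>UNIV. cmod (f k z) * cmod (z $ k))"
    unfolding conj_pairing_def by (rule sum_norm_le) (simp add: norm_mult)
  then have "(cmod (conj_pairing f z))\<^sup>2 \<le> (\<Sum>k\<in>UNIV. cmod (f k z) * cmod (z $ k))\<^sup>2"
    by (rule power_mono) simp
  also have "\<dots> \<le> (\<Sum>k\<in>UNIV. (cmod (f k z))\<^sup>2) * (\<Sum>k\<in>UNIV. (cmod (z $ k))\<^sup>2)"
    by (rule Cauchy_Schwarz_ineq_sum)
  also have "(\<Sum>k\<in>UNIV. (cmod (z $ k))\<^sup>2) = (norm z)\<^sup>2"
    by (simp add: norm_vec_def L2_set_def sum_nonneg)
  finally show ?thesis by (simp only: mult.commute)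
qed

text \<open>Subtracting an entire function does not affect d-bar, so the projection remainder still
  solves the equation. The norm comparison is kept in the conclusion because it transfers every
  later estimate to \<open>conj_pairing f\<close>.\<close>

lemma canonical_solution_exists:
  fixes p :: "complex^'n \<Rightarrow> real"
  assumes psh: "plurisubharmonic p" and s: "s > 0"
    and f: "\<And>k. entire (f k)" and u0: "conj_pairing f \<in> L2w p s"
  shows "\<exists>u. canonical_solution p s f u \<and> wnorm2 p s u \<le> wnorm2 p s (conj_pairing f)"
proof -
  let ?M = "weighted_measure p s"
  have p: "p \<in> borel_measurable borel" by (rule plurisubharmonic_borel_measurable[OF psh])
  have sq0: "sq_integrable ?M (conj_pairing f)" using u0 by (simp add: L2w_iff_sq_integrable[OF p])
  obtain h where h: "h \<in> A2w p s" "\<And>g. g \<in> A2w p s \<Longrightarrow> l2_inner ?M (\<lambda>x. conj_pairing f x - h x) g = 0"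
    "l2_norm2 ?M (\<lambda>x. conj_pairing f x - h x) \<le> l2_norm2 ?M (conj_pairing f)"
  proof (rule l2_projection_exists[of "A2w p s" ?M "conj_pairing f"])
    show "\<exists>h. (\<forall>x. (\<lambda>n. X n x) \<longlonglongrightarrow> h x) \<and> (sq_integrable ?M h \<longrightarrow> h \<in> A2w p s)"
      if "\<And>n. X n \<in> A2w p s"
        "\<And>e. e > 0 \<Longrightarrow> \<exists>N. \<forall>m\<ge>N. \<forall>n\<ge>N. l2_norm2 ?M (\<lambda>x. X m x - X n x) < e" for X
      using that by (rule A2w_cauchy_limit[OF psh s])
    show "sq_integrable ?M h" if "h \<in> A2w p s" for h using that A2w_iff[OF p] by blast
  qed (use sq0 in \<open>auto intro: A2w_zero[OF p] A2w_add[OF p] A2w_cmult[OF p]\<close>)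
  let ?u = "\<lambda>x. conj_pairing f x - h x"
  have uL: "?u \<in> L2w p s"
    unfolding L2w_iff_sq_integrable[OF p] using sq0 h(1) A2w_iff[OF p] by (blast intro: sq_integrable_diff)
  have "weak_dbar ?u f"
    unfolding conj_pairing_def using h(1) by (intro weak_dbar_conj_pairing f) (simp add: A2w_def)
  moreover have "winner p s ?u g = 0" if g: "g \<in> A2w p s" for g
    using h(2)[OF g] uL A2w_lebesgue_measurable[OF g]
    by (subst winner_eq_l2_inner[OF p]) (auto simp: L2w_def)
  ultimately have "canonical_solution p s f ?u" using uL by (simp add: canonical_solution_def)
  moreover have "wnorm2 p s ?u \<le> wnorm2 p s (conj_pairing f)"
    unfolding wnorm2_eq_l2_norm2[OF p uL] wnorm2_eq_l2_norm2[OF p u0] using h(3) by (rule ennreal_leI)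
  ultimately show ?thesis by blast
qed

section \<open>Orthonormal families of forms and the Hilbert-Schmidt bound\<close>

lemma form_inner_eq:
  assumes p: "p \<in> borel_measurable borel" and f: "f \<in> A2forms p t" and g: "g \<in> A2forms p t"
  shows "form_inner p t f g = (\<Sum>j\<in>UNIV. l2_inner (weighted_measure p t) (f j) (g j))"
  unfolding form_inner_def
  using f g by (intro sum.cong refl winner_eq_l2_inner[OF p] A2w_lebesgue_measurable) (auto simp: A2forms_def)

text \<open>Zorn's lemma gives a maximal orthonormal family; a form of nonzero norm orthogonal to it
  could be normalised and adjoined, contradicting maximality.\<close>

lemma form_onb_exists:
  fixes p :: "complex^'n \<Rightarrow> real"
  assumes p: "p \<in> borel_measurable borel"
  shows "\<exists>B. form_onb p t B"
proof -
  let ?M = "weighted_measure p t"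
  define \<A> where "\<A> = {B. B \<subseteq> A2forms p t \<and> (\<forall>b\<in>B. \<forall>b'\<in>B. form_inner p t b b' = (if b = b' then 1 else 0))}"
  have "\<exists>M\<in>\<A>. \<forall>X\<in>\<A>. M \<subseteq> X \<longrightarrow> X = M"
  proof (rule subset_Zorn')
    fix C assume C: "subset.chain \<A> C"
    have "form_inner p t b b' = (if b = b' then 1 else 0)" if b: "b \<in> \<Union>C" "b' \<in> \<Union>C" for b b'
    proof -
      \<comment> \<open>Orthonormality concerns two elements at a time, and any two elements of the
        union already lie in one member of the chain.\<close>
      obtain X Y where "X \<in> C" "Y \<in> C" "b \<in> X" "b' \<in> Y" using b by blast
      then obtain Z where "Z \<in> C" "b \<in> Z" "b' \<in> Z" using C unfolding subset_chain_def by blast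
      then show ?thesis using C unfolding subset_chain_def \<A>_def by blast
    qed
    moreover have "\<Union>C \<subseteq> A2forms p t" using C unfolding subset_chain_def \<A>_def by blast
    ultimately show "\<Union>C \<in> \<A>" unfolding \<A>_def by blast
  qed
  then obtain B where B: "B \<in> \<A>" and max: "\<And>X. X \<in> \<A> \<Longrightarrow> B \<subseteq> X \<Longrightarrow> X = B" by blast
  have BA: "B \<subseteq> A2forms p t" and on: "\<And>b b'. b \<in> B \<Longrightarrow> b' \<in> B \<Longrightarrow> form_inner p t b b' = (if b = b' then 1 else 0)"
    using B unfolding \<A>_def by auto
  have "form_norm2 p t f = 0" if f: "f \<in> A2forms p t" and orth: "\<forall>b\<in>B. form_inner p t f b = 0" for f
  proof (rule ccontr)
    assume ne: "form_norm2 p t f \<noteq> 0"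
    define N where "N = (\<Sum>j\<in>UNIV. l2_norm2 ?M (f j))"
    have "form_norm2 p t f = (\<Sum>j\<in>UNIV. ennreal (l2_norm2 ?M (f j)))"
      unfolding form_norm2_def using f
      by (intro sum.cong refl wnorm2_eq_l2_norm2[OF p]) (auto simp: A2forms_def A2w_def)
    also have "\<dots> = ennreal N" unfolding N_def by (rule sum_ennreal) (rule l2_norm2_nonneg)
    finally have "N \<noteq> 0" using ne by auto
    moreover have "N \<ge> 0" unfolding N_def by (intro sum_nonneg l2_norm2_nonneg)
    ultimately have N: "N > 0" by simp
    define c :: complex where "c = of_real (1 / sqrt N)"
    define g where "g = (\<lambda>j z. c * f j z)"
    have gA: "g \<in> A2forms p t" using f A2w_cmult[OF p] by (auto simp: A2forms_def g_def)
    have gl: "form_inner p t g b = c * form_inner p t f b" if "b \<in> A2forms p t" for b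
      unfolding form_inner_eq[OF p gA that] form_inner_eq[OF p f that]
      by (simp add: g_def l2_inner_cmult_left sum_distrib_left)
    have gb: "form_inner p t g b = 0" if "b \<in> B" for b using gl[of b] orth that BA by auto
    have bg: "form_inner p t b g = 0" if "b \<in> B" for b
    proof -
      have bA: "b \<in> A2forms p t" using that BA by blast
      have "form_inner p t b g = cnj (form_inner p t g b)"
        unfolding form_inner_eq[OF p gA bA] form_inner_eq[OF p bA gA] cnj_sum
        by (intro sum.cong refl l2_inner_commute)
      then show ?thesis using gb[OF that] by simp
    qed
    have "form_inner p t g g = (\<Sum>j\<in>UNIV. of_real ((cmod c)\<^sup>2 * l2_norm2 ?M (f j)))"
      unfolding form_inner_eq[OF p gA gA] l2_inner_self by (simp add: g_def l2_norm2_cmult)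
    also have "\<dots> = of_real ((cmod c)\<^sup>2 * N)" by (simp add: N_def sum_distrib_left)
    also have "(cmod c)\<^sup>2 * N = 1" unfolding c_def using N by (simp add: norm_divide power_divide)
    finally have gg: "form_inner p t g g = 1" by simp
    have gB: "g \<notin> B" using gb[of g] gg by auto
    have "insert g B \<in> \<A>" unfolding \<A>_def using gA BA on gb bg gg gB by auto
    then have "insert g B = B" by (intro max) auto
    then show False using gB by blast
  qed
  then show ?thesis unfolding form_onb_def using BA on by blast
qed

text \<open>Evaluate the form \<open>\<Sum>b\<in>F. cnj (b j z) * b\<close>, which realises the reproducing kernel of
  the span of \<open>F\<close> at \<open>z\<close>.\<close>

lemma orthonormal_evaluation_bound:
  fixes p :: "complex^'n \<Rightarrow> real"
  assumes psh: "plurisubharmonic p" and t: "t > 0" and F: "finite F" "F \<subseteq> A2forms p t"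
    and on: "\<And>b b'. b \<in> F \<Longrightarrow> b' \<in> F \<Longrightarrow> form_inner p t b b' = (if b = b' then 1 else 0)"
  shows "(\<Sum>b\<in>F. (cmod (b j z))\<^sup>2) \<le> exp (2 * t * ptilde p z) / unit_ball_vol (DIM(complex^'n))"
proof -
  let ?M = "weighted_measure p t"
  let ?K = "exp (2 * t * ptilde p z) / unit_ball_vol (DIM(complex^'n))"
  have p: "p \<in> borel_measurable borel" by (rule plurisubharmonic_borel_measurable[OF psh])
  define s where "s = (\<Sum>b\<in>F. (cmod (b j z))\<^sup>2)"
  define a where "a b = cnj (b j z)" for b
  define g where "g = (\<lambda>k w. \<Sum>b\<in>F. a b * b k w)"
  have FA: "b k \<in> A2w p t" if "b \<in> F" for b k using that F by (auto simp: A2forms_def)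
  have gA: "g k \<in> A2w p t" for k unfolding g_def by (intro A2w_sum[OF p F(1)] A2w_cmult[OF p] FA)
  have sqF: "sq_integrable ?M (b k)" if "b \<in> F" for b k using FA[OF that] A2w_iff[OF p] by blast
  have "complex_of_real (\<Sum>k\<in>UNIV. l2_norm2 ?M (g k)) = (\<Sum>k\<in>UNIV. l2_inner ?M (g k) (g k))"
    by (simp add: l2_inner_self)
  also have "\<dots> = (\<Sum>k\<in>UNIV. \<Sum>b\<in>F. \<Sum>b'\<in>F. a b * cnj (a b') * l2_inner ?M (b k) (b' k))"
    unfolding g_def by (intro sum.cong refl l2_inner_sum_sum F sqF)
  also have "\<dots> = (\<Sum>b\<in>F. \<Sum>k\<in>UNIV. \<Sum>b'\<in>F. a b * cnj (a b') * l2_inner ?M (b k) (b' k))"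
    by (rule sum.swap)
  also have "\<dots> = (\<Sum>b\<in>F. \<Sum>b'\<in>F. \<Sum>k\<in>UNIV. a b * cnj (a b') * l2_inner ?M (b k) (b' k))"
    by (intro sum.cong refl sum.swap)
  also have "\<dots> = (\<Sum>b\<in>F. \<Sum>b'\<in>F. a b * cnj (a b') * form_inner p t b b')"
    using F by (intro sum.cong refl) (auto simp: form_inner_eq[OF p] sum_distrib_left subsetD)
  also have "\<dots> = (\<Sum>b\<in>F. \<Sum>b'\<in>F. if b = b' then a b * cnj (a b') else 0)"
    by (intro sum.cong refl) (auto simp: on)
  also have "\<dots> = (\<Sum>b\<in>F. a b * cnj (a b))" using F by (simp add: sum.delta')
  also have "\<dots> = of_real s" 
    unfolding s_def a_def of_real_sum complex_norm_square by (simp add: mult.commute)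
  finally have gs: "(\<Sum>k\<in>UNIV. l2_norm2 ?M (g k)) = s" by (simp only: of_real_eq_iff)
  \<comment> \<open>Evaluation at \<open>z\<close> sees only coefficient \<open>j\<close>, whose
    norm is at most that of the whole form \<open>g\<close>.\<close>
  have "l2_norm2 ?M (g j) \<le> (\<Sum>k\<in>UNIV. l2_norm2 ?M (g k))"
    by (rule member_le_sum) (auto simp: l2_norm2_nonneg)
  then have gj: "l2_norm2 ?M (g j) \<le> s" using gs by simp
  have "g j z = of_real s" 
    unfolding g_def s_def a_def of_real_sum complex_norm_square by (simp add: mult.commute)
  moreover have s0: "s \<ge> 0" unfolding s_def by (intro sum_nonneg) auto
  ultimately have "s\<^sup>2 = (cmod (g j z))\<^sup>2" by simp
  also have "\<dots> \<le> ?K * l2_norm2 ?M (g j)" by (rule A2w_point_evaluation[OF psh t gA])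
  also have "\<dots> \<le> ?K * s" using gj by (intro mult_left_mono) auto
  \<comment> \<open>The weights \<open>a\<close> make \<open>s\<close> both the value
    \<open>g j z\<close> and the squared norm of the form \<open>g\<close>, so one factor
    \<open>s\<close> can be cancelled; for \<open>s = 0\<close> the claim is positivity of
    \<open>?K\<close>.\<close>
  finally have "s * s \<le> ?K * s" by (simp add: power2_eq_square)
  then have "s \<le> ?K"
  proof (cases "s = 0")
    case False
    then have "0 < s" using s0 by simp
    with \<open>s * s \<le> ?K * s\<close> show ?thesis by (rule mult_right_le_imp_le)
  qed auto
  then show ?thesis unfolding s_def .
qed

text \<open>Kept general in \<open>F\<close> and \<open>K\<close> for two uses: with a single form
  it shows that \<open>conj_pairing f\<close> lies in \<open>L2w p \<sigma>\<close>, and with finite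
  orthonormal sets it gives a bound independent of \<open>F\<close>.\<close>

lemma sum_wnorm2_conj_pairing_le:
  fixes p :: "complex^'n \<Rightarrow> real"
  assumes p: "p \<in> borel_measurable borel" and F: "finite F"
    and ent: "\<And>b k. b \<in> F \<Longrightarrow> entire (b k)"
    and decay: "\<And>z. exp (2 * \<tau> * ptilde p z - 2 * \<sigma> * p z) \<le> C * exp (- a * norm z)"
    and C: "C > 0" and K: "K \<ge> 0"
    and bd: "\<And>z. (\<Sum>b\<in>F. \<Sum>k\<in>UNIV. (cmod (b k z))\<^sup>2) \<le> exp (2 * \<tau> * ptilde p z) * K"
  shows "(\<Sum>b\<in>F. wnorm2 p \<sigma> (conj_pairing b))
    \<le> ennreal (K * C) * (\<integral>\<^sup>+z. ennreal ((norm z)\<^sup>2 * exp (- a * norm (z::complex^'n))) \<partial>lborel)"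
proof -
  note [measurable] = p
  have [measurable]: "conj_pairing b \<in> borel_measurable borel" if "b \<in> F" for b
    unfolding conj_pairing_def
    by (intro borel_measurable_continuous_onI continuous_intros entire_continuous_on ent that)
  have "(\<Sum>b\<in>F. wnorm2 p \<sigma> (conj_pairing b))
     = (\<integral>\<^sup>+z. (\<Sum>b\<in>F. ennreal ((cmod (conj_pairing b z))\<^sup>2 * exp (-2 * \<sigma> * p z))) \<partial>lborel)"
    unfolding wnorm2_def nn_integral_completion by (rule nn_integral_sum[symmetric]) measurable
  also have "\<dots> \<le> (\<integral>\<^sup>+z. ennreal (K * C) * ennreal ((norm z)\<^sup>2 * exp (- a * norm (z::complex^'n))) \<partial>lborel)"
  proof (rule nn_integral_mono)
    fix z :: "complex^'n"
    have "(\<Sum>b\<in>F. (cmod (conj_pairing b z))\<^sup>2 * exp (-2 * \<sigma> * p z))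
        \<le> (\<Sum>b\<in>F. (norm z)\<^sup>2 * (\<Sum>k\<in>UNIV. (cmod (b k z))\<^sup>2) * exp (-2 * \<sigma> * p z))"
      by (intro sum_mono mult_right_mono conj_pairing_norm_le) auto
    also have "\<dots> = (norm z)\<^sup>2 * exp (-2 * \<sigma> * p z) * (\<Sum>b\<in>F. \<Sum>k\<in>UNIV. (cmod (b k z))\<^sup>2)"
      by (simp add: sum_distrib_left mult_ac)
    also have "\<dots> \<le> (norm z)\<^sup>2 * exp (-2 * \<sigma> * p z) * (exp (2 * \<tau> * ptilde p z) * K)"
      by (intro mult_left_mono bd) auto
    also have "\<dots> = (norm z)\<^sup>2 * K * exp (2 * \<tau> * ptilde p z - 2 * \<sigma> * p z)"
      by (simp add: exp_diff exp_minus field_simps)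
    also have "\<dots> \<le> (norm z)\<^sup>2 * K * (C * exp (- a * norm z))"
      using K by (intro mult_left_mono decay) auto
    also have "\<dots> = K * C * ((norm z)\<^sup>2 * exp (- a * norm z))" by (simp only: mult_ac)
    finally have "(\<Sum>b\<in>F. (cmod (conj_pairing b z))\<^sup>2 * exp (-2 * \<sigma> * p z)) \<le> K * C * ((norm z)\<^sup>2 * exp (- a * norm z))" .
    then show "(\<Sum>b\<in>F. ennreal ((cmod (conj_pairing b z))\<^sup>2 * exp (-2 * \<sigma> * p z)))
       \<le> ennreal (K * C) * ennreal ((norm z)\<^sup>2 * exp (- a * norm z))"
      using K C by (simp add: sum_ennreal ennreal_mult[symmetric] ennreal_leI)
  qed
  also have "\<dots> = ennreal (K * C) * (\<integral>\<^sup>+z. ennreal ((norm z)\<^sup>2 * exp (- a * norm (z::complex^'n))) \<partial>lborel)"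
    by (rule nn_integral_cmult) measurable
  finally show ?thesis .
qed

theorem theorem4p1:
  fixes p :: "complex^'n \<Rightarrow> real"
  assumes psh: "plurisubharmonic p"
    and conj_finite: "\<forall>w. legendre_conj p w < \<infinity>"
    and tilde_lim: "((\<lambda>z. ptilde p z / p z) \<longlongrightarrow> 1) at_infinity"
    and sigma: "\<sigma> > 0"
  shows "\<exists>\<tau>. 0 < \<tau> \<and> \<tau> < \<sigma> \<and>
           (\<exists>S. (\<forall>f\<in>A2forms p \<tau>. canonical_solution p \<sigma> f (S f)) \<and> hilbert_schmidt p \<tau> \<sigma> S)"
proof -
  \<comment> \<open>The decay estimate holds for every \<tau> strictly between 0 and \<sigma>; half
    of \<sigma> is a convenient choice.\<close>
  define \<tau> where "\<tau> = \<sigma> / 2"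
  have \<tau>: "0 < \<tau>" "\<tau> < \<sigma>" using sigma by (auto simp: \<tau>_def)
  let ?V = "unit_ball_vol (DIM(complex^'n))"
  let ?M = "weighted_measure p \<tau>"
  have p: "p \<in> borel_measurable borel" by (rule plurisubharmonic_borel_measurable[OF psh])
  obtain a C where a: "a > 0" and C: "C > 0"
    and decay: "\<And>z. exp (2 * \<tau> * ptilde p z - 2 * \<sigma> * p z) \<le> C * exp (- a * norm z)"
    using exp_ptilde_decay[OF psh conj_finite tilde_lim \<tau>] by blast
  let ?I = "\<integral>\<^sup>+z. ennreal ((norm z)\<^sup>2 * exp (- a * norm (z::complex^'n))) \<partial>lborel"
  have I: "?I < \<infinity>" by (rule nn_integral_norm_square_exp_finite[OF a])
  have ent: "entire (f k)" if "f \<in> A2forms p \<tau>" for f k using that by (simp add: A2forms_def A2w_def)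
  have L2: "conj_pairing f \<in> L2w p \<sigma>" if f: "f \<in> A2forms p \<tau>" for f
  proof -
    \<comment> \<open>For an arbitrary form, the evaluation bounds of its coefficients add up to its
      squared norm over \<open>?V\<close>.\<close>
    define K where "K = (\<Sum>k\<in>UNIV. l2_norm2 ?M (f k)) / ?V"
    have K: "K \<ge> 0" unfolding K_def by (intro divide_nonneg_nonneg sum_nonneg l2_norm2_nonneg) simp
    have "(\<Sum>k\<in>UNIV. (cmod (f k z))\<^sup>2) \<le> (\<Sum>k\<in>UNIV. exp (2 * \<tau> * ptilde p z) / ?V * l2_norm2 ?M (f k))" for z
      using f by (intro sum_mono A2w_point_evaluation[OF psh \<tau>(1)]) (auto simp: A2forms_def)
    then have bd: "(\<Sum>b\<in>{f}. \<Sum>k\<in>UNIV. (cmod (b k z))\<^sup>2) \<le> exp (2 * \<tau> * ptilde p z) * K" for z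
      unfolding K_def by (simp add: sum_distrib_left sum_divide_distrib)
    have "(\<Sum>b\<in>{f}. wnorm2 p \<sigma> (conj_pairing b)) \<le> ennreal (K * C) * ?I"
      by (rule sum_wnorm2_conj_pairing_le[OF p _ _ decay C K bd]) (use ent[OF f] in auto)
    also have "\<dots> < \<infinity>" using I by (simp add: ennreal_mult_less_top)
    finally have "wnorm2 p \<sigma> (conj_pairing f) < \<infinity>" by simp
    moreover have "conj_pairing f \<in> borel_measurable lebesgue"
      unfolding conj_pairing_def
      by (intro borel_imp_lebesgue_measurable borel_measurable_continuous_onI continuous_intros
          entire_continuous_on ent[OF f])
    ultimately show ?thesis by (simp add: L2w_def)
  qed
  have "\<forall>f\<in>A2forms p \<tau>. \<exists>u. canonical_solution p \<sigma> f u \<and> wnorm2 p \<sigma> u \<le> wnorm2 p \<sigma> (conj_pairing f)"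
    using canonical_solution_exists[OF psh sigma] ent L2 by blast
  then obtain S where S: "\<And>f. f \<in> A2forms p \<tau> \<Longrightarrow> canonical_solution p \<sigma> f (S f)"
    "\<And>f. f \<in> A2forms p \<tau> \<Longrightarrow> wnorm2 p \<sigma> (S f) \<le> wnorm2 p \<sigma> (conj_pairing f)"
    by metis
  obtain B where B: "form_onb p \<tau> B" using form_onb_exists[OF p] by blast
  \<comment> \<open>One evaluation bound \<open>1 / ?V\<close> for each of the
    \<open>CARD('n)\<close> coefficients, with no dependence on the finite set \<open>F\<close>
    below.\<close>
  define K where "K = real (CARD('n)) / ?V"
  have K: "K \<ge> 0" unfolding K_def by simp
  have "(SUP F\<in>{F. finite F \<and> F \<subseteq> B}. \<Sum>b\<in>F. wnorm2 p \<sigma> (S b)) \<le> ennreal (K * C) * ?I"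
  proof (rule SUP_least)
    fix F assume "F \<in> {F. finite F \<and> F \<subseteq> B}"
    then have F: "finite F" "F \<subseteq> B" by auto
    then have FA: "F \<subseteq> A2forms p \<tau>" using B unfolding form_onb_def by blast
    have "(\<Sum>b\<in>F. (cmod (b k z))\<^sup>2) \<le> exp (2 * \<tau> * ptilde p z) / ?V" for k z
      using F B by (intro orthonormal_evaluation_bound[OF psh \<tau>(1) F(1) FA]) (auto simp: form_onb_def subset_iff)
    then have "(\<Sum>k\<in>(UNIV::'n set). \<Sum>b\<in>F. (cmod (b k z))\<^sup>2) \<le> (\<Sum>k\<in>(UNIV::'n set). exp (2 * \<tau> * ptilde p z) / ?V)" for z
      by (intro sum_mono)
    then have bd: "(\<Sum>b\<in>F. \<Sum>k\<in>UNIV. (cmod (b k z))\<^sup>2) \<le> exp (2 * \<tau> * ptilde p z) * K" for z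
      unfolding K_def by (subst sum.swap) (simp add: mult.commute)
    have "(\<Sum>b\<in>F. wnorm2 p \<sigma> (S b)) \<le> (\<Sum>b\<in>F. wnorm2 p \<sigma> (conj_pairing b))"
      using FA by (intro sum_mono S) auto
    also have "\<dots> \<le> ennreal (K * C) * ?I"
      by (rule sum_wnorm2_conj_pairing_le[OF p F(1) _ decay C K bd]) (use ent FA in auto)
    finally show "(\<Sum>b\<in>F. wnorm2 p \<sigma> (S b)) \<le> ennreal (K * C) * ?I" .
  qed
  also have "\<dots> < \<infinity>" using I by (simp add: ennreal_mult_less_top)
  finally have "hilbert_schmidt p \<tau> \<sigma> S" unfolding hilbert_schmidt_def using B by blast
  then show ?thesis using \<tau> S(1) by blast
qed

end
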